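(* Let $X_1, X_2$ be finite CW-complexes, let $\phi: X_1\to X_2$ be a homotopy equivalence, let $\xi_i\in H^1(X_i;\mathbf{R})$ for $i=1,2$, and assume that $\xi_1=\phi^\ast(\xi_2)\in H^1(X_1;\mathbf{R})$. Then $\mathrm{Cat}(X_1,\xi_1)=\mathrm{Cat}(X_2,\xi_2)$.
   Context: Continuous closed 1-forms. A continuous closed 1-form $\omega$ on a topological space $X$ is given by a collection $\{f_U\}_{U\in\mathcal U}$ of continuous functions $f_U:U\to\mathbf{R}$, where $\mathcal U$ is an open cover of $X$, such that for all $U,V\in\mathcal U$ the difference $f_U|_{U\cap V}-f_V|_{U\cap V}$ is locally constant. Two such collections $\{f_U\}_{U\in\mathcal U}$, $\{g_V\}_{V\in\mathcal V}$ define the same closed 1-form if $f_U-g_V$ is locally constant on $U\cap V$ for all $U\in\mathcal U$, $V\in\mathcal V$. For a continuous path $\gamma:[\alpha,\beta]\to X$ the line integral is $\int_\gamma\omega=\sum_{i=0}^{N-1}[f_{U_i}(\gamma(t_{i+1}))-f_{U_i}(\gamma(t_i))]$, where $\alpha=t_0<t_1<\dots<t_N=\beta$ is a subdivision with $\gamma([t_i,t_{i+1}])\subset U_i\in\mathcal U$; it is independent of the choices. The cohomology class $[\omega]\in H^1(X;\mathbf{R})=\mathrm{Hom}(H_1(X),\mathbf{R})$ is the homomorphism of periods $[\gamma]\mapsto\int_\gamma\omega$ on closed loops. On a finite CW-complex every class $\xi\in H^1(X;\mathbf{R})$ is represented by a continuous closed 1-form. Definition of $\mathrm{Cat}(X,\xi)$.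 Let $X$ be a finite CW-complex, $\xi\in H^1(X;\mathbf{R})$, and fix a continuous closed 1-form $\omega$ on $X$ representing $\xi$. $\mathrm{Cat}(X,\xi)$ is the least integer $k\ge 0$ such that there exists an open cover $X=F\cup F_1\cup\dots\cup F_k$ (where $F$ may be empty) with: (a) each inclusion $F_j\to X$, $j=1,\dots,k$, is null-homotopic; (b) there exists a homotopy $h_t:F\to X$, $t\in(-\infty,+\infty)$, such that $h_0$ is the inclusion $F\to X$ and for any integer $n>0$ there exists $N>0$ such that for all $x\in F$: $\int_x^{h_t(x)}\omega>n$ whenever $t>N$, and $\int_x^{h_t(x)}\omega<-n$ whenever $t<-N$. Here, for $t>0$, $\int_x^{h_t(x)}\omega$ is the integral along the curve $[0,t]\to X$, $\tau\mapsto h_\tau(x)$, and for $t<0$ it is the integral along the curve $[0,-t]\to X$, $\tau\mapsto h_{-\tau}(x)$. The number $\mathrm{Cat}(X,\xi)$ does not depend on the choice of $\omega$ representing $\xi$. *)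

theory Defs
  imports "HOL-Homology.Homology"
begin

section \<open>Finite CW-complexes\<close>

definition cw_disc :: "nat \<Rightarrow> (nat \<Rightarrow> real) topology" where
  "cw_disc n = subtopology (Euclidean_space n) {x. (\<Sum>i<n. x i ^ 2) \<le> 1}"

definition disc_interior :: "nat \<Rightarrow> (nat \<Rightarrow> real) set" where
  "disc_interior n = {x \<in> topspace (cw_disc n). (\<Sum>i<n. x i ^ 2) < 1}"

definition disc_boundary :: "nat \<Rightarrow> (nat \<Rightarrow> real) set" where
  "disc_boundary n = {x \<in> topspace (cw_disc n). (\<Sum>i<n. x i ^ 2) = 1}"

text \<open>
  A finite CW structure with \<open>m\<close> cells; the cell number \<open>i < m\<close> has dimension \<open>d i\<close> and
  characteristic map \<open>\<Phi> i\<close>.  Closure finiteness and the weak topology are automatic because there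
  are finitely many cells, whose closures are compact in a Hausdorff space.
\<close>

definition finite_CW_structure ::
    "'a topology \<Rightarrow> nat \<Rightarrow> (nat \<Rightarrow> nat) \<Rightarrow> (nat \<Rightarrow> (nat \<Rightarrow> real) \<Rightarrow> 'a) \<Rightarrow> bool" where
  "finite_CW_structure X m d \<Phi> \<longleftrightarrow>
     (\<forall>i<m. continuous_map (cw_disc (d i)) X (\<Phi> i)) \<and>
     (\<forall>i<m. homeomorphic_map (subtopology (cw_disc (d i)) (disc_interior (d i)))
                (subtopology X (\<Phi> i ` disc_interior (d i))) (\<Phi> i)) \<and>
     (\<forall>i<m. \<forall>j<m. i \<noteq> j \<longrightarrow>
        \<Phi> i ` disc_interior (d i) \<inter> \<Phi> j ` disc_interior (d j) = {}) \<and>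
     topspace X = (\<Union>i<m. \<Phi> i ` disc_interior (d i)) \<and>
     (\<forall>i<m. \<Phi> i ` disc_boundary (d i)
        \<subseteq> (\<Union>j\<in>{j. j < m \<and> d j < d i}. \<Phi> j ` disc_interior (d j)))"

definition finite_CW_complex :: "'a topology \<Rightarrow> bool" where
  "finite_CW_complex X \<longleftrightarrow> Hausdorff_space X \<and> (\<exists>m d \<Phi>. finite_CW_structure X m d \<Phi>)"

section \<open>Homotopy equivalences\<close>

definition homotopy_equivalence_map :: "'a topology \<Rightarrow> 'b topology \<Rightarrow> ('a \<Rightarrow> 'b) \<Rightarrow> bool" where
  "homotopy_equivalence_map X Y f \<longleftrightarrow>
     continuous_map X Y f \<and>
     (\<exists>g. continuous_map Y X g \<and>
          homotopic_with (\<lambda>_. True) X X (g \<circ> f) id \<and>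
          homotopic_with (\<lambda>_. True) Y Y (f \<circ> g) id)"

definition null_homotopic_inclusion :: "'a topology \<Rightarrow> 'a set \<Rightarrow> bool" where
  "null_homotopic_inclusion X S \<longleftrightarrow>
     (\<exists>a\<in>topspace X. homotopic_with (\<lambda>_. True) (subtopology X S) X id (\<lambda>_. a))"

section \<open>First real cohomology\<close>

definition real_group :: "real monoid" where
  "real_group = \<lparr>carrier = UNIV, monoid.mult = (+), one = 0\<rparr>"

text \<open>Cohomology classes are made extensional, so that equality of classes is equality in HOL.\<close>

definition real_H1 :: "'a topology \<Rightarrow> ('a chain set \<Rightarrow> real) set" where
  "real_H1 X = hom (homology_group 1 X) real_group \<inter> extensional (carrier (homology_group 1 X))"

definition pullback_H1 ::
    "'a topology \<Rightarrow> 'b topology \<Rightarrow> ('a \<Rightarrow> 'b) \<Rightarrow> ('b chain set \<Rightarrow> real) \<Rightarrow> 'a chain set \<Rightarrow> real" where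
  "pullback_H1 X Y f \<xi> = (\<lambda>c\<in>carrier (homology_group 1 X). \<xi> (hom_induced 1 X {} Y {} f c))"

text \<open>
  The standard 1-simplex is parametrised by its second barycentric coordinate \<open>x 1 \<in> {0..1}\<close>,
  running from vertex 0 to vertex 1.
\<close>

definition loop_class :: "'a topology \<Rightarrow> (real \<Rightarrow> 'a) \<Rightarrow> 'a chain set" where
  "loop_class X \<gamma> =
     homologous_rel_set 1 X {} (frag_of (restrict (\<lambda>x. \<gamma> (x 1)) (standard_simplex 1)))"

section \<open>Continuous closed 1-forms\<close>

definition locally_constant_on :: "'a topology \<Rightarrow> 'a set \<Rightarrow> ('a \<Rightarrow> real) \<Rightarrow> bool" where
  "locally_constant_on X S g \<longleftrightarrow>
     (\<forall>x\<in>S. \<exists>W. openin (subtopology X S) W \<and> x \<in> W \<and> (\<forall>y\<in>W. g y = g x))"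

text \<open>A pair \<open>(\<U>, f)\<close> stands for the family \<open>f U\<close>, \<open>U \<in> \<U>\<close>.\<close>

type_synonym 'a form_family = "'a set set \<times> ('a set \<Rightarrow> 'a \<Rightarrow> real)"

definition form_families :: "'a topology \<Rightarrow> 'a form_family set" where
  "form_families X =
     {(\<U>, f). (\<forall>U\<in>\<U>. openin X U) \<and> \<Union>\<U> = topspace X \<and>
        (\<forall>U\<in>\<U>. continuous_map (subtopology X U) euclideanreal (f U)) \<and>
        (\<forall>U\<in>\<U>. \<forall>V\<in>\<U>. locally_constant_on X (U \<inter> V) (\<lambda>x. f U x - f V x))}"

definition same_form :: "'a topology \<Rightarrow> ('a form_family \<times> 'a form_family) set" where
  "same_form X =
     {((\<U>, f), (\<V>, g)). (\<U>, f) \<in> form_families X \<and> (\<V>, g) \<in> form_families X \<and>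
        (\<forall>U\<in>\<U>. \<forall>V\<in>\<V>. locally_constant_on X (U \<inter> V) (\<lambda>x. f U x - g V x))}"

definition closed_1forms :: "'a topology \<Rightarrow> 'a form_family set set" where
  "closed_1forms X = form_families X // same_form X"

text \<open>
  The value does not depend on the representing family, on the subdivision or on the choice of the
  sets \<open>U i\<close>, so the description below is proper for every path \<open>\<gamma>\<close> that is continuous
  on \<open>{\<alpha>..\<beta>}\<close>.
\<close>

definition line_integral :: "'a form_family set \<Rightarrow> (real \<Rightarrow> 'a) \<Rightarrow> real \<Rightarrow> real \<Rightarrow> real" where
  "line_integral \<omega> \<gamma> \<alpha> \<beta> =
     (THE I. \<exists>\<U> f. (\<U>, f) \<in> \<omega> \<and>
        (\<exists>(N::nat) t U. t 0 = \<alpha> \<and> t N = \<beta> \<and>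
           (\<forall>i<N. t i < t (Suc i) \<and> U i \<in> \<U> \<and> \<gamma> ` {t i..t (Suc i)} \<subseteq> U i) \<and>
           I = (\<Sum>i<N. f (U i) (\<gamma> (t (Suc i))) - f (U i) (\<gamma> (t i)))))"

text \<open>
  \<open>[\<omega>] = \<xi>\<close>: since the classes of loops generate the first homology group, the periods determine
  the homomorphism.
\<close>

definition represents :: "'a topology \<Rightarrow> 'a form_family set \<Rightarrow> ('a chain set \<Rightarrow> real) \<Rightarrow> bool" where
  "represents X \<omega> \<xi> \<longleftrightarrow>
     \<omega> \<in> closed_1forms X \<and> \<xi> \<in> real_H1 X \<and>
     (\<forall>\<gamma>. pathin X \<gamma> \<and> \<gamma> 0 = \<gamma> 1 \<longrightarrow> \<xi> (loop_class X \<gamma>) = line_integral \<omega> \<gamma> 0 1)"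

section \<open>The number Cat\<close>

definition movable :: "'a topology \<Rightarrow> 'a form_family set \<Rightarrow> 'a set \<Rightarrow> bool" where
  "movable X \<omega> F \<longleftrightarrow>
     (\<exists>h :: real \<Rightarrow> 'a \<Rightarrow> 'a.
        continuous_map (prod_topology euclideanreal (subtopology X F)) X (\<lambda>(t, x). h t x) \<and>
        (\<forall>x\<in>F. h 0 x = x) \<and>
        (\<forall>n::int. n > 0 \<longrightarrow>
           (\<exists>N::real. N > 0 \<and>
              (\<forall>x\<in>F. (\<forall>t. t > N \<longrightarrow> line_integral \<omega> (\<lambda>\<tau>. h \<tau> x) 0 t > of_int n) \<and>
                     (\<forall>t. t < - N \<longrightarrow> line_integral \<omega> (\<lambda>\<tau>. h (- \<tau>) x) 0 (- t) < - of_int n)))))"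

definition Cat_cover :: "'a topology \<Rightarrow> 'a form_family set \<Rightarrow> nat \<Rightarrow> bool" where
  "Cat_cover X \<omega> k \<longleftrightarrow>
     (\<exists>F G. openin X F \<and> (\<forall>j\<in>{1..k}. openin X (G j)) \<and>
        topspace X = F \<union> (\<Union>j\<in>{1..k}. G j) \<and>
        (\<forall>j\<in>{1..k}. null_homotopic_inclusion X (G j)) \<and>
        movable X \<omega> F)"

text \<open>
  A representing form is fixed by choice.  On a finite CW-complex every class in \<open>real_H1 X\<close> is
  represented by a form; the value 0 is only a default for classes (of other spaces) without any
  representing form.
\<close>

definition Cat :: "'a topology \<Rightarrow> ('a chain set \<Rightarrow> real) \<Rightarrow> nat" where
  "Cat X \<xi> =
     (if \<exists>\<omega>. represents X \<omega> \<xi>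
      then (LEAST k. Cat_cover X (SOME \<omega>. represents X \<omega> \<xi>) k)
      else 0)"

end

theory Submission
  imports Defs
begin

text \<open>
  Let \<open>\<psi>\<close> be a homotopy inverse of \<open>\<phi>\<close>.  A cover of \<open>X\<^sub>2\<close> is pulled back along \<open>\<phi>\<close>;  on the preimage
  of \<open>F\<close> one first follows the homotopy from the identity to \<open>\<psi> \<circ> \<phi>\<close> and then the curves
  \<open>\<psi> (h\<^sub>t (\<phi> x))\<close>.  The first part changes the integrals by a bounded amount because \<open>X\<^sub>1\<close> is compact.
  On the second part one integrates \<open>\<psi>\<^sup>*\<omega>\<^sub>1\<close> along \<open>h\<^sub>t (\<phi> x)\<close>, and integrals of two forms in the same
  class differ by a bounded amount, uniformly over all paths: up to the radial paths in the cells,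
  whose integrals are bounded by compactness, the difference depends only on the two cell centres
  joined.  The situation is symmetric, and the pullbacks also show that \<open>\<xi>\<^sub>1\<close> is represented by a form
  if and only if \<open>\<xi>\<^sub>2\<close> is, so no existence theorem for forms is needed.
\<close>

section \<open>Line integrals via primitives\<close>

text \<open>A homotopy enters only through integrals along its tracks, but
  \<open>line_integral\<close> is a definite description over representing families, subdivisions
  and cover members. A primitive along a path removes these choices. It is a real function of time
  that differs from \<open>g V \<circ> \<gamma>\<close> by a locally constant function wherever the
  path meets a member \<open>V\<close> of any representing family. Such a function lifts the path to
  the values of a multivalued integral. Additivity, reparametrisation and pullback then become
  statements about endpoint values, without common refinements of subdivisions. Bounded errors have
  to be allowed because the forms on the two spaces are fixed by independent choices, so neither
  need be the pullback of the other. They are harmless because movability asks only for uniform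
  divergence. Two forms in one class are compared through the endpoints of paths instead of a
  function whose differential is their difference, so no continuity in the endpoint has to be
  arranged.\<close>

definition primitive_along ::
    "'a form_family set \<Rightarrow> (real \<Rightarrow> 'a) \<Rightarrow> real \<Rightarrow> real \<Rightarrow> (real \<Rightarrow> real) \<Rightarrow> bool" where
  "primitive_along \<omega> \<gamma> a b P \<longleftrightarrow>
     (\<forall>(\<V>, g)\<in>\<omega>. \<forall>V\<in>\<V>. \<forall>s\<in>{a..b}. \<gamma> s \<in> V \<longrightarrow>
        (\<exists>d>0. \<forall>u\<in>{a..b}. \<bar>u - s\<bar> < d \<longrightarrow> P u - g V (\<gamma> u) = P s - g V (\<gamma> s)))"

lemma primitive_alongD:
  assumes "primitive_along \<omega> \<gamma> a b P" "(\<V>, g) \<in> \<omega>" "V \<in> \<V>" "s \<in> {a..b}" "\<gamma> s \<in> V"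
  obtains d where "d > 0"
    "\<And>u. \<lbrakk>u \<in> {a..b}; \<bar>u - s\<bar> < d\<rbrakk> \<Longrightarrow> P u - g V (\<gamma> u) = P s - g V (\<gamma> s)"
  using assms unfolding primitive_along_def by fast

lemma primitive_alongI:
  assumes "\<And>\<V> g V s. \<lbrakk>(\<V>, g) \<in> \<omega>; V \<in> \<V>; s \<in> {a..b}; \<gamma> s \<in> V\<rbrakk> \<Longrightarrow>
     \<exists>d>0. \<forall>u\<in>{a..b}. \<bar>u - s\<bar> < d \<longrightarrow> P u - g V (\<gamma> u) = P s - g V (\<gamma> s)"
  shows "primitive_along \<omega> \<gamma> a b P"
  using assms unfolding primitive_along_def by blast

lemma primitive_along_subinterval:
  assumes "primitive_along \<omega> \<gamma> a b P" "a \<le> c" "d \<le> b"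
  shows "primitive_along \<omega> \<gamma> c d P"
proof (rule primitive_alongI)
  fix \<V> g V s assume *: "(\<V>, g) \<in> \<omega>" "V \<in> \<V>" "s \<in> {c..d}" "\<gamma> s \<in> V"
  then obtain e where "e > 0" "\<And>u. \<lbrakk>u \<in> {a..b}; \<bar>u - s\<bar> < e\<rbrakk> \<Longrightarrow> P u - g V (\<gamma> u) = P s - g V (\<gamma> s)"
    using primitive_alongD [OF assms(1) *(1,2), of s] assms by auto
  then show "\<exists>e>0. \<forall>u\<in>{c..d}. \<bar>u - s\<bar> < e \<longrightarrow> P u - g V (\<gamma> u) = P s - g V (\<gamma> s)"
    using assms by (intro exI [of _ e]) auto
qed

lemma primitive_along_cong:
  assumes "primitive_along \<omega> \<gamma> a b P" "\<And>s. s \<in> {a..b} \<Longrightarrow> \<gamma> s = \<delta> s"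
  shows "primitive_along \<omega> \<delta> a b P"
proof (rule primitive_alongI)
  fix \<V> g V s assume *: "(\<V>, g) \<in> \<omega>" "V \<in> \<V>" "s \<in> {a..b}" "\<delta> s \<in> V"
  then have "\<gamma> s \<in> V" using assms(2) by simp
  from primitive_alongD [OF assms(1) *(1-3) this] obtain e where
    "e > 0" "\<And>u. \<lbrakk>u \<in> {a..b}; \<bar>u - s\<bar> < e\<rbrakk> \<Longrightarrow> P u - g V (\<gamma> u) = P s - g V (\<gamma> s)"
    by blast
  then show "\<exists>d>0. \<forall>u\<in>{a..b}. \<bar>u - s\<bar> < d \<longrightarrow> P u - g V (\<delta> u) = P s - g V (\<delta> s)"
    using assms(2) *(3) by metis
qed

text \<open>Near \<open>s\<close> the values of \<sigma> stay near \<open>\<sigma> s\<close>, which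
  is all that the local condition asks of it. As \<sigma> may run forwards or backwards, this serves
  reparametrisation and reversal alike.\<close>

lemma primitive_along_compose:
  assumes P: "primitive_along \<omega> \<gamma> a b P" and cont: "continuous_on {c..d} \<sigma>"
    and im: "\<sigma> \<in> {c..d} \<rightarrow> {a..b}"
  shows "primitive_along \<omega> (\<lambda>t. \<gamma> (\<sigma> t)) c d (\<lambda>t. P (\<sigma> t))"
proof (rule primitive_alongI)
  fix \<V> g V s assume *: "(\<V>, g) \<in> \<omega>" "V \<in> \<V>" "s \<in> {c..d}" "\<gamma> (\<sigma> s) \<in> V"
  then obtain e where e: "e > 0"
    "\<And>u. \<lbrakk>u \<in> {a..b}; \<bar>u - \<sigma> s\<bar> < e\<rbrakk> \<Longrightarrow> P u - g V (\<gamma> u) = P (\<sigma> s) - g V (\<gamma> (\<sigma> s))"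
    using primitive_alongD [OF P *(1,2), of "\<sigma> s"] im by (auto simp: Pi_iff)
  obtain k where "k > 0" "\<And>u. \<lbrakk>u \<in> {c..d}; \<bar>u - s\<bar> < k\<rbrakk> \<Longrightarrow> \<bar>\<sigma> u - \<sigma> s\<bar> < e"
    using cont \<open>e > 0\<close> *(3) unfolding continuous_on_iff dist_real_def by metis
  then show "\<exists>k>0. \<forall>u\<in>{c..d}. \<bar>u - s\<bar> < k \<longrightarrow>
        P (\<sigma> u) - g V (\<gamma> (\<sigma> u)) = P (\<sigma> s) - g V (\<gamma> (\<sigma> s))"
    using e im by (intro exI [of _ k]) (auto simp: Pi_iff)
qed

lemma locally_constant_real_interval:
  fixes F :: "real \<Rightarrow> real"
  assumes "a \<le> b"
    and loc: "\<And>s. s \<in> {a..b} \<Longrightarrow> \<exists>d>0. \<forall>u\<in>{a..b}. \<bar>u - s\<bar> < d \<longrightarrow> F u = F s"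
  shows "F a = F b"
proof (rule connected_local_const [of "{a..b}" a b F])
  show "\<forall>s\<in>{a..b}. eventually (\<lambda>u. F s = F u) (at s within {a..b})"
  proof
    fix s assume "s \<in> {a..b}"
    from loc [OF this] obtain d where "d > 0" "\<forall>u\<in>{a..b}. \<bar>u - s\<bar> < d \<longrightarrow> F u = F s"
      by blast
    then show "eventually (\<lambda>u. F s = F u) (at s within {a..b})"
      unfolding eventually_at by (intro exI [of _ d]) (simp add: dist_real_def)
  qed
qed (use assms in auto)

text \<open>While the path stays in one member, \<open>P\<close> minus
  \<open>g V \<circ> \<gamma>\<close> is locally constant on an interval, hence constant. This
  identifies increments of a primitive with the summands of a line integral.\<close>

lemma primitive_along_diff_in_set:
  assumes P: "primitive_along \<omega> \<gamma> a b P" and "(\<V>, g) \<in> \<omega>" "V \<in> \<V>" "\<gamma> ` {a..b} \<subseteq> V" "a \<le> b"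
  shows "P b - P a = g V (\<gamma> b) - g V (\<gamma> a)"
proof -
  have "P a - g V (\<gamma> a) = P b - g V (\<gamma> b)"
  proof (rule locally_constant_real_interval [of a b "\<lambda>s. P s - g V (\<gamma> s)"])
    fix s assume s: "s \<in> {a..b}"
    with assms(4) have "\<gamma> s \<in> V" by blast
    from primitive_alongD [OF P assms(2,3) s this]
    show "\<exists>d>0. \<forall>u\<in>{a..b}. \<bar>u - s\<bar> < d \<longrightarrow> P u - g V (\<gamma> u) = P s - g V (\<gamma> s)"
      by metis
  qed fact
  then show ?thesis by simp
qed

lemma closed_1form_representative:
  assumes "\<omega> \<in> closed_1forms X"
  obtains \<U> f where "(\<U>, f) \<in> form_families X" "\<omega> = same_form X `` {(\<U>, f)}" "(\<U>, f) \<in> \<omega>"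
proof -
  obtain \<U> f where *: "(\<U>, f) \<in> form_families X" "\<omega> = same_form X `` {(\<U>, f)}"
    using assms unfolding closed_1forms_def quotient_def by auto
  \<comment> \<open>Reflexivity of \<open>same_form\<close> is the compatibility clause of
    \<open>form_families\<close>.\<close>
  moreover have "((\<U>, f), (\<U>, f)) \<in> same_form X"
    using * unfolding same_form_def form_families_def by auto
  ultimately show ?thesis
    using that by blast
qed

lemma closed_1form_family:
  assumes "\<omega> \<in> closed_1forms X" "(\<V>, g) \<in> \<omega>"
  shows "(\<V>, g) \<in> form_families X"
  using assms unfolding closed_1forms_def quotient_def same_form_def by auto

lemma path_eventually_in_open:
  assumes \<gamma>: "continuous_map (top_of_set {a..b}) X \<gamma>" and "openin X W" "s \<in> {a..b}" "\<gamma> s \<in> W"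
  obtains d :: real where "d > 0" "\<And>u. \<lbrakk>u \<in> {a..b}; \<bar>u - s\<bar> < d\<rbrakk> \<Longrightarrow> \<gamma> u \<in> W"
proof -
  have "openin (top_of_set {a..b}) {u \<in> {a..b}. \<gamma> u \<in> W}"
    using openin_continuous_map_preimage [OF \<gamma> \<open>openin X W\<close>] by simp
  then obtain d where "d > 0" "\<And>u. u \<in> {a..b} \<Longrightarrow> dist u s < d \<Longrightarrow> u \<in> {u \<in> {a..b}. \<gamma> u \<in> W}"
    using assms unfolding openin_euclidean_subtopology_iff by blast
  then show ?thesis
    using that by (auto simp: dist_real_def)
qed

text \<open>Inside one member \<open>U\<close> of the family that spans the class,
  \<open>f U\<close> along the path is a primitive. The point to check is agreement with every other
  family of the class, which is what \<open>same_form\<close> provides.\<close>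

lemma primitive_along_local:
  assumes \<gamma>: "continuous_map (top_of_set {a..b}) X \<gamma>" and \<omega>: "\<omega> = same_form X `` {(\<U>, f)}"
    and U: "U \<in> \<U>" "\<gamma> ` {a..b} \<subseteq> U"
  shows "primitive_along \<omega> \<gamma> a b (\<lambda>u. f U (\<gamma> u))"
proof (rule primitive_alongI)
  fix \<V> g V s assume *: "(\<V>, g) \<in> \<omega>" "V \<in> \<V>" "s \<in> {a..b}" "\<gamma> s \<in> V"
  have same: "((\<U>, f), (\<V>, g)) \<in> same_form X"
    using *(1) \<omega> by simp
  then have fam: "(\<U>, f) \<in> form_families X" "(\<V>, g) \<in> form_families X"
    and loc: "locally_constant_on X (U \<inter> V) (\<lambda>x. f U x - g V x)"
    using U(1) *(2) by (simp_all add: same_form_def)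
  have op: "openin X U" "openin X V"
    using fam U(1) *(2) by (simp_all add: form_families_def)
  have "\<gamma> s \<in> U \<inter> V"
    using U(2) *(3,4) by auto
  then obtain W where W: "openin (subtopology X (U \<inter> V)) W" "\<gamma> s \<in> W"
      "\<And>y. y \<in> W \<Longrightarrow> f U y - g V y = f U (\<gamma> s) - g V (\<gamma> s)"
    using loc unfolding locally_constant_on_def by metis
  have "openin X W"
    using openin_trans_full [OF W(1)] op by blast
  then obtain d where "d > 0" "\<And>u. \<lbrakk>u \<in> {a..b}; \<bar>u - s\<bar> < d\<rbrakk> \<Longrightarrow> \<gamma> u \<in> W"
    using path_eventually_in_open [OF \<gamma> _ *(3) W(2)] by metis
  then show "\<exists>d>0. \<forall>u\<in>{a..b}. \<bar>u - s\<bar> < d \<longrightarrow>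
      f U (\<gamma> u) - g V (\<gamma> u) = f U (\<gamma> s) - g V (\<gamma> s)"
    using W(3) by blast
qed

text \<open>A primitive matters only up to a constant, so \<open>Q\<close> is shifted by
  \<open>P c - Q c\<close> to meet \<open>P\<close> at \<open>c\<close>. Away from \<open>c\<close>
  one of the two local conditions suffices; at \<open>c\<close> both are combined.\<close>

lemma primitive_along_join:
  assumes P: "primitive_along \<omega> \<gamma> a c P" and Q: "primitive_along \<omega> \<gamma> c b Q"
  shows "primitive_along \<omega> \<gamma> a b (\<lambda>u. if u \<le> c then P u else Q u - Q c + P c)"
    (is "primitive_along _ _ _ _ ?R")
proof (rule primitive_alongI)
  fix \<V> g V s assume *: "(\<V>, g) \<in> \<omega>" "V \<in> \<V>" "s \<in> {a..b}" "\<gamma> s \<in> V"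
  \<comment> \<open>The guards on \<open>u\<close> and \<open>s\<close> provide a radius for either
    side before any case split; it is vacuous if \<open>s\<close> lies strictly on the other
    side.\<close>
  have "\<exists>d>0. \<forall>u\<in>{a..b}. u \<le> c \<and> s \<le> c \<and> \<bar>u - s\<bar> < d \<longrightarrow> P u - g V (\<gamma> u) = P s - g V (\<gamma> s)"
  proof (cases "s \<le> c")
    case True
    then show ?thesis
      using primitive_alongD [OF P *(1,2), of s] *(3,4) by (metis atLeastAtMost_iff)
  qed (auto intro: exI [of _ 1])
  then obtain d where d: "d > 0" 
    "\<And>u. \<lbrakk>u \<in> {a..b}; u \<le> c; s \<le> c; \<bar>u - s\<bar> < d\<rbrakk> \<Longrightarrow> P u - g V (\<gamma> u) = P s - g V (\<gamma> s)"
    by blast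
  have "\<exists>d>0. \<forall>u\<in>{a..b}. u \<ge> c \<and> s \<ge> c \<and> \<bar>u - s\<bar> < d \<longrightarrow> Q u - g V (\<gamma> u) = Q s - g V (\<gamma> s)"
  proof (cases "s \<ge> c")
    case True
    then show ?thesis
      using primitive_alongD [OF Q *(1,2), of s] *(3,4) by (metis atLeastAtMost_iff)
  qed (auto intro: exI [of _ 1])
  then obtain e where e: "e > 0" 
    "\<And>u. \<lbrakk>u \<in> {a..b}; u \<ge> c; s \<ge> c; \<bar>u - s\<bar> < e\<rbrakk> \<Longrightarrow> Q u - g V (\<gamma> u) = Q s - g V (\<gamma> s)"
    by blast
  \<comment> \<open>The third entry keeps \<open>u\<close> on the same side of \<open>c\<close> as
    \<open>s\<close>; for \<open>s = c\<close> no such restriction applies and 1 is a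
    placeholder.\<close>
  define k where "k = Min {d, e, if s = c then 1 else \<bar>s - c\<bar>}"
  have "k > 0"
    unfolding k_def using d(1) e(1) by auto
  have "?R u - g V (\<gamma> u) = ?R s - g V (\<gamma> s)" if "u \<in> {a..b}" "\<bar>u - s\<bar> < k" for u
  proof -
    have k: "\<bar>u - s\<bar> < d" "\<bar>u - s\<bar> < e" "s \<noteq> c \<Longrightarrow> \<bar>u - s\<bar> < \<bar>s - c\<bar>"
      using that unfolding k_def by (auto split: if_splits)
    consider "s < c" "u < c" | "s > c" "u > c" | "s = c"
      using k(3) by argo
    then show ?thesis
    proof cases
      case 1
      with d(2) [OF that(1)] k show ?thesis by auto
    next
      case 2
      with e(2) [OF that(1)] k show ?thesis by auto
    next
      case 3
      with d(2) [OF that(1)] e(2) [OF that(1)] k show ?thesis by (cases "u \<le> c") auto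
    qed
  qed
  with \<open>k > 0\<close> show "\<exists>k>0. \<forall>u\<in>{a..b}. \<bar>u - s\<bar> < k \<longrightarrow> ?R u - g V (\<gamma> u) = ?R s - g V (\<gamma> s)"
    by blast
qed

section \<open>Subdivisions and the value of the line integral\<close>

definition subdivided :: "'a set set \<Rightarrow> (real \<Rightarrow> 'a) \<Rightarrow> real \<Rightarrow> real \<Rightarrow> nat \<Rightarrow> (nat \<Rightarrow> real) \<Rightarrow>
    (nat \<Rightarrow> 'a set) \<Rightarrow> bool" where
  "subdivided \<U> \<gamma> a b N t U \<longleftrightarrow> t 0 = a \<and> t N = b \<and>
     (\<forall>i<N. t i < t (Suc i) \<and> U i \<in> \<U> \<and> \<gamma> ` {t i..t (Suc i)} \<subseteq> U i)"

text \<open>Points and pieces are offset by one: index \<open>N\<close> is still a point of the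
  first subdivision but already a piece of the second. At this index the two sequences of points
  agree, as both \<open>t N\<close> and \<open>r 0\<close> equal \<open>c\<close>.\<close>

lemma subdivided_append:
  assumes "subdivided \<U> \<gamma> a c N t U" "subdivided \<U> \<gamma> c b M r V"
  shows "subdivided \<U> \<gamma> a b (N + M) (\<lambda>i. if i \<le> N then t i else r (i - N))
           (\<lambda>i. if i < N then U i else V (i - N))"
proof -
  let ?t = "\<lambda>i. if i \<le> N then t i else r (i - N)"
  let ?U = "\<lambda>i. if i < N then U i else V (i - N)"
  have tN: "t N = r 0" using assms by (simp add: subdivided_def)
  have "?t i < ?t (Suc i) \<and> ?U i \<in> \<U> \<and> \<gamma> ` {?t i..?t (Suc i)} \<subseteq> ?U i" if i: "i < N + M" for i
  proof (cases "i < N")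
    case True
    then show ?thesis using assms(1) by (simp add: subdivided_def)
  next
    case False
    then have "i - N < M" "?t i = r (i - N)" "?t (Suc i) = r (Suc (i - N))" "?U i = V (i - N)"
      using i tN by (auto simp: Suc_diff_le)
    then show ?thesis using assms(2) by (simp only: subdivided_def)
  qed
  moreover have "?t 0 = a" "?t (N + M) = b"
    using assms tN by (auto simp: subdivided_def)
  ultimately show ?thesis
    unfolding subdivided_def by blast
qed

text \<open>This takes the place of a Lebesgue number. A property of intervals that survives
  concatenation and holds on pieces mapped into one cover member holds on the whole interval, by
  bisection. It yields both primitives and subdivisions.\<close>

lemma path_interval_induct:
  fixes a b :: real
  assumes \<gamma>: "continuous_map (top_of_set {a..b}) X \<gamma>" and "a \<le> b"
    and \<U>: "(\<U>, f) \<in> form_families X"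
    and trans: "\<And>c d e. \<lbrakk>a \<le> c; c \<le> d; d \<le> e; e \<le> b; Q c d; Q d e\<rbrakk> \<Longrightarrow> Q c e"
    and loc: "\<And>c d U. \<lbrakk>a \<le> c; c \<le> d; d \<le> b; U \<in> \<U>; \<gamma> ` {c..d} \<subseteq> U\<rbrakk> \<Longrightarrow> Q c d"
  shows "Q a b"
proof -
  \<comment> \<open>The local premise of \<open>Bolzano\<close> speaks of all short intervals around
    a point, also those leaving \<open>{a..b}\<close>, where the path is not controlled; hence the
    implication.\<close>
  have "a \<le> a \<and> b \<le> b \<longrightarrow> Q a b"
  proof (rule Bolzano [OF \<open>a \<le> b\<close>, where P = "\<lambda>c d. a \<le> c \<and> d \<le> b \<longrightarrow> Q c d"])
    show "a \<le> c \<and> e \<le> b \<longrightarrow> Q c e"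
      if "a \<le> c \<and> d \<le> b \<longrightarrow> Q c d" "a \<le> d \<and> e \<le> b \<longrightarrow> Q d e" "c \<le> d" "d \<le> e" for c d e
      using that trans [of c d e] by auto
    fix s assume s: "a \<le> s" "s \<le> b"
    then have "\<gamma> s \<in> topspace X"
      using continuous_map_image_subset_topspace [OF \<gamma>] by auto
    moreover have "\<Union>\<U> = topspace X" and op: "\<And>U. U \<in> \<U> \<Longrightarrow> openin X U"
      using \<U> by (simp_all add: form_families_def)
    ultimately obtain U where U: "U \<in> \<U>" "\<gamma> s \<in> U" "openin X U"
      by blast
    obtain k where k: "k > 0" "\<And>u. \<lbrakk>u \<in> {a..b}; \<bar>u - s\<bar> < k\<rbrakk> \<Longrightarrow> \<gamma> u \<in> U"
      using path_eventually_in_open [OF \<gamma> \<open>openin X U\<close>] s U by auto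
    have "\<gamma> ` {c..d} \<subseteq> U" if "c \<le> s \<and> s \<le> d \<and> d - c < k" "a \<le> c \<and> d \<le> b" for c d
      using that by (auto intro!: k(2))
    then show "\<exists>k>0. \<forall>c d. c \<le> s \<and> s \<le> d \<and> d - c < k \<longrightarrow> a \<le> c \<and> d \<le> b \<longrightarrow> Q c d"
      using k(1) U(1) loc by (intro exI [of _ k]) auto
  qed
  then show ?thesis by simp
qed

lemma exists_primitive_along:
  assumes \<omega>: "\<omega> \<in> closed_1forms X" and \<gamma>: "continuous_map (top_of_set {a..b}) X \<gamma>" and "a \<le> b"
  obtains P where "primitive_along \<omega> \<gamma> a b P"
proof -
  obtain \<U> f where \<U>: "(\<U>, f) \<in> form_families X" "\<omega> = same_form X `` {(\<U>, f)}"
    using closed_1form_representative [OF \<omega>] .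
  have "\<exists>P. primitive_along \<omega> \<gamma> a b P"
  proof (rule path_interval_induct [OF \<gamma> \<open>a \<le> b\<close> \<U>(1),
        where Q = "\<lambda>c d. \<exists>P. primitive_along \<omega> \<gamma> c d P"])
    show "\<exists>P. primitive_along \<omega> \<gamma> c e P"
      if "\<exists>P. primitive_along \<omega> \<gamma> c d P" "\<exists>P. primitive_along \<omega> \<gamma> d e P" for c d e
      using that primitive_along_join by blast
  next
    fix c d U assume local: "a \<le> c" "c \<le> d" "d \<le> b" "U \<in> \<U>" "\<gamma> ` {c..d} \<subseteq> U"
    have "continuous_map (top_of_set {c..d}) X \<gamma>"
      by (rule continuous_map_from_subtopology_mono [OF \<gamma>]) (use local in auto)
    then show "\<exists>P. primitive_along \<omega> \<gamma> c d P"
      using primitive_along_local [OF _ \<U>(2) local(4,5)] by blast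
  qed
  then show ?thesis using that by blast
qed

lemma exists_subdivided:
  assumes \<U>: "(\<U>, f) \<in> form_families X" and \<gamma>: "continuous_map (top_of_set {a..b}) X \<gamma>" and "a \<le> b"
  obtains N t U where "subdivided \<U> \<gamma> a b N t U"
proof -
  have "\<exists>N t U. subdivided \<U> \<gamma> a b N t U"
  proof (rule path_interval_induct [OF \<gamma> \<open>a \<le> b\<close> \<U>,
        where Q = "\<lambda>c d. \<exists>N t U. subdivided \<U> \<gamma> c d N t U"])
    show "\<exists>N t U. subdivided \<U> \<gamma> c e N t U"
      if "\<exists>N t U. subdivided \<U> \<gamma> c d N t U" "\<exists>N t U. subdivided \<U> \<gamma> d e N t U" for c d e
      using that subdivided_append by blast
  next
    fix c d U assume local: "a \<le> c" "c \<le> d" "d \<le> b" "U \<in> \<U>" "\<gamma> ` {c..d} \<subseteq> U"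
    show "\<exists>N t U. subdivided \<U> \<gamma> c d N t U"
    \<comment> \<open>Subdivision points increase strictly, so a degenerate interval needs
      \<open>N = 0\<close>.\<close>
    proof (cases "c = d")
      case True
      then show ?thesis
        by (intro exI [of _ "0::nat"] exI [of _ "\<lambda>_. c"]) (auto simp: subdivided_def)
    next
      case False
      with local show ?thesis
        by (intro exI [of _ "1::nat"] exI [of _ "\<lambda>i. if i = 0 then c else d"] exI [of _ "\<lambda>_. U"])
          (auto simp: subdivided_def)
    qed
  qed
  then show ?thesis using that by blast
qed

text \<open>On each piece the summand is an increment of \<open>P\<close>, so the sum telescopes.
  The right-hand side mentions neither family nor subdivision, which is the independence of choices
  behind \<open>line_integral\<close>.\<close>

lemma subdivided_sum_eq:
  assumes P: "primitive_along \<omega> \<gamma> a b P" and A: "(\<U>, f) \<in> \<omega>" and t: "subdivided \<U> \<gamma> a b N t U"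
  shows "(\<Sum>i<N. f (U i) (\<gamma> (t (Suc i))) - f (U i) (\<gamma> (t i))) = P b - P a"
proof -
  have mono: "t i \<le> t j" if "i \<le> j" "j \<le> N" for i j
    using that
  proof (induction j rule: dec_induct)
    case (step n)
    then have "t n < t (Suc n)" using t by (simp add: subdivided_def)
    with step show ?case by linarith
  qed auto
  have "(\<Sum>i<N. f (U i) (\<gamma> (t (Suc i))) - f (U i) (\<gamma> (t i))) = (\<Sum>i<N. P (t (Suc i)) - P (t i))"
  proof (rule sum.cong [OF refl])
    fix i assume "i \<in> {..<N}"
    then have "i < N" by simp
    then have *: "t i \<le> t (Suc i)" "U i \<in> \<U>" "\<gamma> ` {t i..t (Suc i)} \<subseteq> U i"
      using t by (auto simp: subdivided_def)
    have "a \<le> t i" "t (Suc i) \<le> b"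
      using mono [of 0 i] mono [of "Suc i" N] \<open>i < N\<close> t by (auto simp: subdivided_def)
    then show "f (U i) (\<gamma> (t (Suc i))) - f (U i) (\<gamma> (t i)) = P (t (Suc i)) - P (t i)"
      using primitive_along_diff_in_set [OF primitive_along_subinterval [OF P] A *(2,3,1)] by simp
  qed
  also have "\<dots> = P b - P a"
    using t sum_lessThan_telescope [of "\<lambda>i. P (t i)" N] by (simp add: subdivided_def)
  finally show ?thesis .
qed

text \<open>Any subdivision witnesses the value, and telescoping forces every other admissible value
  to equal it, so the definite description is proper. From here on integrals are handled through
  primitives.\<close>

proposition line_integral_eq_primitive:
  assumes \<omega>: "\<omega> \<in> closed_1forms X" and \<gamma>: "continuous_map (top_of_set {a..b}) X \<gamma>" and "a \<le> b"
    and P: "primitive_along \<omega> \<gamma> a b P"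
  shows "line_integral \<omega> \<gamma> a b = P b - P a"
proof -
  obtain \<U> f where A: "(\<U>, f) \<in> form_families X" "(\<U>, f) \<in> \<omega>"
    using closed_1form_representative [OF \<omega>] by metis
  obtain N t U where t: "subdivided \<U> \<gamma> a b N t U"
    using exists_subdivided [OF A(1) \<gamma> \<open>a \<le> b\<close>] .
  have eq: "line_integral \<omega> \<gamma> a b = (THE I. \<exists>\<U> f. (\<U>, f) \<in> \<omega> \<and> (\<exists>N t U. subdivided \<U> \<gamma> a b N t U \<and>
           I = (\<Sum>i<N. f (U i) (\<gamma> (t (Suc i))) - f (U i) (\<gamma> (t i)))))"
    unfolding line_integral_def subdivided_def by (simp add: conj_assoc)
  show ?thesis
    unfolding eq
  proof (rule the_equality)
    show "\<exists>\<U> f. (\<U>, f) \<in> \<omega> \<and> (\<exists>N t U. subdivided \<U> \<gamma> a b N t U \<and>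
        P b - P a = (\<Sum>i<N. f (U i) (\<gamma> (t (Suc i))) - f (U i) (\<gamma> (t i))))"
      using subdivided_sum_eq [OF P A(2) t] A(2) t by metis
  next
    fix I assume "\<exists>\<U> f. (\<U>, f) \<in> \<omega> \<and> (\<exists>N t U. subdivided \<U> \<gamma> a b N t U \<and>
        I = (\<Sum>i<N. f (U i) (\<gamma> (t (Suc i))) - f (U i) (\<gamma> (t i))))"
    then show "I = P b - P a"
      using subdivided_sum_eq [OF P] by blast
  qed
qed

text \<open>A primitive tested against a single representing family is enough: on one subdivision
  for that family it has the same total increment as a primitive for the whole class. A pulled back
  form is given explicitly by only one family.\<close>

lemma line_integral_eq_primitive_of_family:
  assumes \<omega>: "\<omega> \<in> closed_1forms X" and \<gamma>: "continuous_map (top_of_set {a..b}) X \<gamma>" and "a \<le> b"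
    and A: "(\<U>, f) \<in> \<omega>" and P: "primitive_along {(\<U>, f)} \<gamma> a b P"
  shows "line_integral \<omega> \<gamma> a b = P b - P a"
proof -
  obtain Q where Q: "primitive_along \<omega> \<gamma> a b Q"
    using exists_primitive_along [OF \<omega> \<gamma> \<open>a \<le> b\<close>] .
  obtain N t U where t: "subdivided \<U> \<gamma> a b N t U"
    using exists_subdivided [OF closed_1form_family [OF \<omega> A] \<gamma> \<open>a \<le> b\<close>] .
  have "Q b - Q a = P b - P a"
    using subdivided_sum_eq [OF Q A t] subdivided_sum_eq [OF P _ t, of f] by simp
  then show ?thesis
    using line_integral_eq_primitive [OF \<omega> \<gamma> \<open>a \<le> b\<close> Q] by simp
qed

section \<open>Rules for computing line integrals\<close>

lemma line_integral_in_set: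
  assumes \<omega>: "\<omega> \<in> closed_1forms X" and \<gamma>: "continuous_map (top_of_set {a..b}) X \<gamma>" and "a \<le> b"
    and A: "(\<U>, f) \<in> \<omega>" and U: "U \<in> \<U>" "\<gamma> ` {a..b} \<subseteq> U"
  shows "line_integral \<omega> \<gamma> a b = f U (\<gamma> b) - f U (\<gamma> a)"
proof -
  obtain P where P: "primitive_along \<omega> \<gamma> a b P"
    using exists_primitive_along [OF \<omega> \<gamma> \<open>a \<le> b\<close>] .
  show ?thesis
    using line_integral_eq_primitive [OF \<omega> \<gamma> \<open>a \<le> b\<close> P]
      primitive_along_diff_in_set [OF P A U \<open>a \<le> b\<close>] by simp
qed

lemma line_integral_additive:
  assumes \<omega>: "\<omega> \<in> closed_1forms X" and \<gamma>: "continuous_map (top_of_set {a..b}) X \<gamma>"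
    and "a \<le> c" "c \<le> b"
  shows "line_integral \<omega> \<gamma> a b = line_integral \<omega> \<gamma> a c + line_integral \<omega> \<gamma> c b"
proof -
  have "a \<le> b" using assms by simp
  obtain P where P: "primitive_along \<omega> \<gamma> a b P"
    using exists_primitive_along [OF \<omega> \<gamma> \<open>a \<le> b\<close>] .
  have sub: "continuous_map (top_of_set {a..c}) X \<gamma>" "continuous_map (top_of_set {c..b}) X \<gamma>"
    using continuous_map_from_subtopology_mono [OF \<gamma>] assms by simp_all
  have "primitive_along \<omega> \<gamma> a c P" "primitive_along \<omega> \<gamma> c b P"
    by (rule primitive_along_subinterval [OF P]; use assms in simp)+
  then have "line_integral \<omega> \<gamma> a c = P c - P a" "line_integral \<omega> \<gamma> c b = P b - P c"
    using line_integral_eq_primitive [OF \<omega>] sub assms by blast+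
  then show ?thesis
    using line_integral_eq_primitive [OF \<omega> \<gamma> \<open>a \<le> b\<close> P] by simp
qed

lemma line_integral_cong:
  assumes \<omega>: "\<omega> \<in> closed_1forms X" and \<gamma>: "continuous_map (top_of_set {a..b}) X \<gamma>"
    and "a \<le> b" and eq: "\<And>s. s \<in> {a..b} \<Longrightarrow> \<gamma> s = \<delta> s"
  shows "line_integral \<omega> \<gamma> a b = line_integral \<omega> \<delta> a b"
proof -
  obtain P where P: "primitive_along \<omega> \<gamma> a b P"
    using exists_primitive_along [OF \<omega> \<gamma> \<open>a \<le> b\<close>] .
  have \<delta>: "continuous_map (top_of_set {a..b}) X \<delta>"
    by (rule continuous_map_eq [OF \<gamma>]) (simp add: eq)
  show ?thesis
    using line_integral_eq_primitive [OF \<omega> \<gamma> \<open>a \<le> b\<close> P]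
      line_integral_eq_primitive [OF \<omega> \<delta> \<open>a \<le> b\<close> primitive_along_cong [OF P eq]] by simp
qed

lemma continuous_map_reparametrize:
  fixes \<sigma> :: "real \<Rightarrow> real"
  assumes \<gamma>: "continuous_map (top_of_set {a..b}) X \<gamma>"
    and \<sigma>: "continuous_on {c..d} \<sigma>" "\<sigma> \<in> {c..d} \<rightarrow> {a..b}"
  shows "continuous_map (top_of_set {c..d}) X (\<lambda>t. \<gamma> (\<sigma> t))"
  using continuous_map_compose [OF _ \<gamma>, of "top_of_set {c..d}" \<sigma>] \<sigma>
  by (auto simp: continuous_map_in_subtopology o_def)

text \<open>With a primitive \<open>P\<close> along \<gamma>, the composite of \<open>P\<close> and
  \<sigma> is a primitive along the new path, so only the endpoint values of \<sigma> enter;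
  exchanging them changes the sign.\<close>

lemma
  assumes \<omega>: "\<omega> \<in> closed_1forms X" and \<gamma>: "continuous_map (top_of_set {a..b}) X \<gamma>"
    and "a \<le> b" "c \<le> d"
    and \<sigma>: "continuous_on {c..d} \<sigma>" "\<sigma> \<in> {c..d} \<rightarrow> {a..b}"
  shows line_integral_reparametrize:
      "\<lbrakk>\<sigma> c = a; \<sigma> d = b\<rbrakk> \<Longrightarrow> line_integral \<omega> (\<lambda>t. \<gamma> (\<sigma> t)) c d = line_integral \<omega> \<gamma> a b"
    and line_integral_reverse:
      "\<lbrakk>\<sigma> c = b; \<sigma> d = a\<rbrakk> \<Longrightarrow> line_integral \<omega> (\<lambda>t. \<gamma> (\<sigma> t)) c d = - line_integral \<omega> \<gamma> a b"
proof -
  obtain P where P: "primitive_along \<omega> \<gamma> a b P"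
    using exists_primitive_along [OF \<omega> \<gamma> \<open>a \<le> b\<close>] .
  have eq: "line_integral \<omega> (\<lambda>t. \<gamma> (\<sigma> t)) c d = P (\<sigma> d) - P (\<sigma> c)"
    "line_integral \<omega> \<gamma> a b = P b - P a"
    using line_integral_eq_primitive [OF \<omega> continuous_map_reparametrize [OF \<gamma> \<sigma>] \<open>c \<le> d\<close>
        primitive_along_compose [OF P \<sigma>]]
      line_integral_eq_primitive [OF \<omega> \<gamma> \<open>a \<le> b\<close> P] by simp_all
  show "\<lbrakk>\<sigma> c = a; \<sigma> d = b\<rbrakk> \<Longrightarrow> line_integral \<omega> (\<lambda>t. \<gamma> (\<sigma> t)) c d = line_integral \<omega> \<gamma> a b"
    and "\<lbrakk>\<sigma> c = b; \<sigma> d = a\<rbrakk> \<Longrightarrow> line_integral \<omega> (\<lambda>t. \<gamma> (\<sigma> t)) c d = - line_integral \<omega> \<gamma> a b"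
    using eq by simp_all
qed

section \<open>Pulling back forms and classes\<close>

text \<open>
  Different members of the cover may have the same preimage; \<open>inv_into\<close> selects one of them.
\<close>

definition pullback_family :: "'a topology \<Rightarrow> ('a \<Rightarrow> 'b) \<Rightarrow> 'b form_family \<Rightarrow> 'a form_family" where
  "pullback_family X \<phi> A =
     (let pre = (\<lambda>V. {x \<in> topspace X. \<phi> x \<in> V})
      in (pre ` fst A, \<lambda>U x. snd A (inv_into (fst A) pre U) (\<phi> x)))"

lemma pullback_family_in_form_families:
  assumes \<phi>: "continuous_map X Y \<phi>" and A: "(\<V>, g) \<in> form_families Y"
  shows "pullback_family X \<phi> (\<V>, g) \<in> form_families X"
proof -
  define pre where "pre = (\<lambda>V. {x \<in> topspace X. \<phi> x \<in> V})"
  have op: "openin Y V" and g: "continuous_map (subtopology Y V) euclideanreal (g V)" if "V \<in> \<V>" for V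
    using A that by (simp_all add: form_families_def)
  have Un: "\<Union>\<V> = topspace Y"
    using A by (simp add: form_families_def)
  have loc: "locally_constant_on Y (V \<inter> V') (\<lambda>x. g V x - g V' x)" if "V \<in> \<V>" "V' \<in> \<V>" for V V'
    using A that by (simp add: form_families_def)
  have pre_open: "openin X (pre V)" if "openin Y V" for V
    unfolding pre_def using openin_continuous_map_preimage [OF \<phi> that] .
  have cont: "continuous_map (subtopology X (pre V)) euclideanreal (\<lambda>x. g V (\<phi> x))" if "V \<in> \<V>" for V
  proof -
    have "continuous_map (subtopology X (pre V)) (subtopology Y V) \<phi>"
      using continuous_map_from_subtopology [OF \<phi>] by (auto simp: continuous_map_in_subtopology pre_def)
    from continuous_map_compose [OF this g [OF that]] show ?thesis by (simp add: o_def)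
  qed
  have lc: "locally_constant_on X (pre V \<inter> pre V') (\<lambda>x. g V (\<phi> x) - g V' (\<phi> x))"
    if V: "V \<in> \<V>" "V' \<in> \<V>" for V V'
    unfolding locally_constant_on_def
  proof
    fix x assume x: "x \<in> pre V \<inter> pre V'"
    then have "\<phi> x \<in> V \<inter> V'" by (simp add: pre_def)
    then obtain W where W: "openin (subtopology Y (V \<inter> V')) W" "\<phi> x \<in> W"
      "\<And>y. y \<in> W \<Longrightarrow> g V y - g V' y = g V (\<phi> x) - g V' (\<phi> x)"
      using loc [OF V] unfolding locally_constant_on_def by metis
    have "openin Y W"
      using openin_trans_full [OF W(1)] op V by blast
    moreover have "W \<subseteq> V \<inter> V'"
      using openin_subset [OF W(1)] by simp
    ultimately have "openin (subtopology X (pre V \<inter> pre V')) (pre W)"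
      by (intro subset_openin_subtopology pre_open) (auto simp: pre_def)
    moreover have "g V (\<phi> y) - g V' (\<phi> y) = g V (\<phi> x) - g V' (\<phi> x)" if "y \<in> pre W" for y
      by (rule W(3)) (use that in \<open>simp add: pre_def\<close>)
    moreover have "x \<in> pre W"
      using W(2) x by (simp add: pre_def)
    ultimately show "\<exists>W. openin (subtopology X (pre V \<inter> pre V')) W \<and> x \<in> W \<and>
        (\<forall>y\<in>W. g V (\<phi> y) - g V' (\<phi> y) = g V (\<phi> x) - g V' (\<phi> x))"
      by blast
  qed
  have Un': "\<Union>(pre ` \<V>) = topspace X"
  proof
    show "topspace X \<subseteq> \<Union>(pre ` \<V>)"
    proof
      fix x assume "x \<in> topspace X"
      with continuous_map_image_subset_topspace [OF \<phi>] have "\<phi> x \<in> \<Union>\<V>"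
        unfolding Un by blast
      then show "x \<in> \<Union>(pre ` \<V>)"
        using \<open>x \<in> topspace X\<close> by (auto simp: pre_def)
    qed
  qed (auto simp: pre_def)
  \<comment> \<open>The selected member may differ from the one that produced \<open>U\<close>, but
    it has the same preimage, so continuity and compatibility carry over.\<close>
  have inv: "inv_into \<V> pre U \<in> \<V> \<and> pre (inv_into \<V> pre U) = U" if "U \<in> pre ` \<V>" for U
    using that by (simp add: inv_into_into f_inv_into_f)
  have "openin X U" if "U \<in> pre ` \<V>" for U
    using that pre_open op by blast
  moreover have "continuous_map (subtopology X U) euclideanreal (\<lambda>x. g (inv_into \<V> pre U) (\<phi> x))"
    if "U \<in> pre ` \<V>" for U
    using cont [of "inv_into \<V> pre U"] inv [OF that] by simp
  moreover have "locally_constant_on X (U \<inter> U')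
      (\<lambda>x. g (inv_into \<V> pre U) (\<phi> x) - g (inv_into \<V> pre U') (\<phi> x))"
    if "U \<in> pre ` \<V>" "U' \<in> pre ` \<V>" for U U'
    using lc [of "inv_into \<V> pre U" "inv_into \<V> pre U'"] inv [OF that(1)] inv [OF that(2)] by simp
  ultimately show ?thesis
    using Un' unfolding pullback_family_def form_families_def Let_def pre_def [symmetric] fst_conv snd_conv
    by blast
qed

text \<open>Pulling back changes the path and not the primitive: a primitive for \<omega> along
  \<open>\<phi> \<circ> \<gamma>\<close> is one for the pulled back family along \<gamma>, so both
  integrals are the same increment.\<close>

lemma exists_pullback_form:
  assumes \<phi>: "continuous_map X Y \<phi>" and \<omega>: "\<omega> \<in> closed_1forms Y"
  obtains \<omega>' where "\<omega>' \<in> closed_1forms X"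
    "\<And>\<gamma> a b. \<lbrakk>a \<le> b; continuous_map (top_of_set {a..b}) X \<gamma>\<rbrakk> \<Longrightarrow>
        line_integral \<omega>' \<gamma> a b = line_integral \<omega> (\<lambda>t. \<phi> (\<gamma> t)) a b"
proof -
  obtain \<V> g where A: "(\<V>, g) \<in> form_families Y" "(\<V>, g) \<in> \<omega>"
    using closed_1form_representative [OF \<omega>] by metis
  define pre where "pre = (\<lambda>V. {x \<in> topspace X. \<phi> x \<in> V})"
  obtain \<U> f where B: "pullback_family X \<phi> (\<V>, g) = (\<U>, f)"
    by (metis surj_pair)
  then have Uf: "\<U> = pre ` \<V>" "f = (\<lambda>U x. g (inv_into \<V> pre U) (\<phi> x))"
    unfolding pullback_family_def pre_def by (simp_all add: Let_def)
  have B': "(\<U>, f) \<in> form_families X"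
    using pullback_family_in_form_families [OF \<phi> A(1)] B by simp
  define \<omega>' where "\<omega>' = same_form X `` {(\<U>, f)}"
  have \<omega>': "\<omega>' \<in> closed_1forms X"
    unfolding \<omega>'_def closed_1forms_def using B' by (rule quotientI)
  have "(\<U>, f) \<in> \<omega>'"
    using B' unfolding \<omega>'_def by (simp add: same_form_def) (simp add: form_families_def)
  have "line_integral \<omega>' \<gamma> a b = line_integral \<omega> (\<lambda>t. \<phi> (\<gamma> t)) a b"
    if "a \<le> b" and \<gamma>: "continuous_map (top_of_set {a..b}) X \<gamma>" for \<gamma> a b
  proof -
    have \<phi>\<gamma>: "continuous_map (top_of_set {a..b}) Y (\<lambda>t. \<phi> (\<gamma> t))"
      using continuous_map_compose [OF \<gamma> \<phi>] by (simp add: o_def)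
    obtain P where P: "primitive_along \<omega> (\<lambda>t. \<phi> (\<gamma> t)) a b P"
      using exists_primitive_along [OF \<omega> \<phi>\<gamma> \<open>a \<le> b\<close>] .
    have "primitive_along {(\<U>, f)} \<gamma> a b P"
    proof (rule primitive_alongI)
      fix \<V>' g' U s assume *: "(\<V>', g') \<in> {(\<U>, f)}" "U \<in> \<V>'" "s \<in> {a..b}" "\<gamma> s \<in> U"
      define V where "V = inv_into \<V> pre U"
      have V: "V \<in> \<V>" "pre V = U"
        using * Uf(1) unfolding V_def by (auto simp: inv_into_into f_inv_into_f)
      have "\<phi> (\<gamma> s) \<in> V"
        using V(2) *(4) by (auto simp: pre_def)
      from primitive_alongD [OF P A(2) V(1) *(3) this]
      obtain d where "d > 0" "\<And>u. \<lbrakk>u \<in> {a..b}; \<bar>u - s\<bar> < d\<rbrakk> \<Longrightarrow>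
          P u - g V (\<phi> (\<gamma> u)) = P s - g V (\<phi> (\<gamma> s))"
        by blast
      moreover have "g' U = (\<lambda>x. g V (\<phi> x))"
        using *(1) Uf(2) V_def by simp
      ultimately show "\<exists>d>0. \<forall>u\<in>{a..b}. \<bar>u - s\<bar> < d \<longrightarrow> P u - g' U (\<gamma> u) = P s - g' U (\<gamma> s)"
        by auto
    qed
    from line_integral_eq_primitive_of_family [OF \<omega>' \<gamma> \<open>a \<le> b\<close> \<open>(\<U>, f) \<in> \<omega>'\<close> this]
    show ?thesis
      using line_integral_eq_primitive [OF \<omega> \<phi>\<gamma> \<open>a \<le> b\<close> P] by simp
  qed
  then show ?thesis
    using that \<omega>' by blast
qed

section \<open>Loops as singular cycles and the pullback of classes\<close>

lemma singular_relcycle_loop: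
  assumes "pathin X \<gamma>" "\<gamma> 0 = \<gamma> 1"
  shows "singular_relcycle 1 X {} (frag_of (restrict (\<lambda>x. \<gamma> (x 1)) (standard_simplex 1)))"
    (is "singular_relcycle 1 X {} (frag_of ?c)")
proof -
  have "continuous_map (subtopology (powertop_real UNIV) (standard_simplex 1)) (top_of_set {0..1::real})
          (\<lambda>x. x 1)"
  proof (rule continuous_map_into_subtopology)
    show "continuous_map (subtopology (powertop_real UNIV) (standard_simplex 1)) euclideanreal (\<lambda>x. x 1)"
      by (rule continuous_map_from_subtopology 
            [OF continuous_map_product_projection [where X = "\<lambda>_. euclideanreal"]]) simp
  qed (auto simp: standard_simplex_def)
  from continuous_map_compose [OF this assms(1) [unfolded pathin_def]]
  have "continuous_map (subtopology (powertop_real UNIV) (standard_simplex 1)) X (\<lambda>x. \<gamma> (x 1))"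
    by (simp add: o_def)
  then have c: "singular_simplex 1 X ?c"
    unfolding singular_simplex_def by (auto intro: continuous_map_eq)
  \<comment> \<open>Face 0 sits at \<open>\<gamma> 1\<close> and face 1 at
    \<open>\<gamma> 0\<close>. For a loop they are the same constant 0-simplex, so they cancel in
    the alternating sum.\<close>
  have "singular_face 1 k ?c = restrict (\<lambda>_. \<gamma> 0) (standard_simplex 0)" if "k \<le> 1" for k
  proof -
    have "?c (simplical_face k x) = \<gamma> 0" if "x \<in> standard_simplex 0" for x
    proof -
      have "simplical_face k x \<in> standard_simplex 1"
        using simplical_face_in_standard_simplex [of 1 k x] \<open>k \<le> 1\<close> that by simp
      moreover have "x 0 = 1"
        using that by (simp add: standard_simplex_def)
      moreover have "k = 0 \<or> k = 1" using \<open>k \<le> 1\<close> by auto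
      ultimately show ?thesis
        using assms(2) by (auto simp: simplical_face_def)
    qed
    then show ?thesis
      by (auto simp: singular_face_def restrict_def fun_eq_iff)
  qed
  then have "chain_boundary 1 (frag_of ?c) = 0"
    by (simp add: chain_boundary_of)
  with c show ?thesis
    by (simp add: singular_cycle singular_chain_of)
qed

lemma loop_class_in_homology_group:
  assumes "pathin X \<gamma>" "\<gamma> 0 = \<gamma> 1"
  shows "loop_class X \<gamma> \<in> carrier (homology_group 1 X)"
  using singular_relcycle_loop [OF assms] carrier_relative_homology_group [of 1 X "{}"]
  by (simp add: loop_class_def)

lemma hom_induced_loop_class:
  assumes "continuous_map X Y \<phi>" "pathin X \<gamma>" "\<gamma> 0 = \<gamma> 1"
  shows "hom_induced 1 X {} Y {} \<phi> (loop_class X \<gamma>) = loop_class Y (\<lambda>t. \<phi> (\<gamma> t))"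
proof -
  have "simplex_map 1 \<phi> (restrict (\<lambda>x. \<gamma> (x 1)) (standard_simplex 1)) =
        restrict (\<lambda>x. \<phi> (\<gamma> (x 1))) (standard_simplex 1)"
    by (auto simp: simplex_map_def)
  then show ?thesis
    using hom_induced_chain_map [OF assms(1) _ singular_relcycle_loop [OF assms(2,3)], of "{}"]
    by (simp add: loop_class_def)
qed

text \<open>Periods match by the integral formula together with naturality of
  \<open>loop_class\<close>. The formula is kept in the conclusion because it is needed along paths
  that are not closed.\<close>

lemma represents_pullback:
  assumes \<phi>: "continuous_map X Y \<phi>" and \<omega>: "represents Y \<omega> \<xi>"
    and \<xi>': "pullback_H1 X Y \<phi> \<xi> \<in> real_H1 X"
  obtains \<omega>' where "represents X \<omega>' (pullback_H1 X Y \<phi> \<xi>)"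
    "\<And>\<gamma> a b. \<lbrakk>a \<le> b; continuous_map (top_of_set {a..b}) X \<gamma>\<rbrakk> \<Longrightarrow>
        line_integral \<omega>' \<gamma> a b = line_integral \<omega> (\<lambda>t. \<phi> (\<gamma> t)) a b"
proof -
  have "\<omega> \<in> closed_1forms Y" using \<omega> by (simp add: represents_def)
  then obtain \<omega>' where \<omega>': "\<omega>' \<in> closed_1forms X"
    and int: "\<And>\<gamma> a b. \<lbrakk>a \<le> b; continuous_map (top_of_set {a..b}) X \<gamma>\<rbrakk> \<Longrightarrow>
        line_integral \<omega>' \<gamma> a b = line_integral \<omega> (\<lambda>t. \<phi> (\<gamma> t)) a b"
    using exists_pullback_form [OF \<phi>] by metis
  have "pullback_H1 X Y \<phi> \<xi> (loop_class X \<gamma>) = line_integral \<omega>' \<gamma> 0 1"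
    if \<gamma>: "pathin X \<gamma>" "\<gamma> 0 = \<gamma> 1" for \<gamma>
  proof -
    have "pathin Y (\<lambda>t. \<phi> (\<gamma> t))"
      using pathin_compose [OF \<gamma>(1) \<phi>] by (simp add: o_def)
    then have "\<xi> (loop_class Y (\<lambda>t. \<phi> (\<gamma> t))) = line_integral \<omega> (\<lambda>t. \<phi> (\<gamma> t)) 0 1"
      using \<omega> \<gamma>(2) by (simp add: represents_def)
    then show ?thesis
      using loop_class_in_homology_group [OF \<gamma>] hom_induced_loop_class [OF \<phi> \<gamma>] int [of 0 1 \<gamma>] \<gamma>(1)
      by (simp add: pullback_H1_def pathin_def)
  qed
  then have "represents X \<omega>' (pullback_H1 X Y \<phi> \<xi>)"
    using \<omega>' \<xi>' by (simp add: represents_def)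
  then show ?thesis using that int by blast
qed

text \<open>By functoriality and homotopy invariance, \<open>\<phi> \<circ> \<psi>\<close> induces
  the identity on homology. Extensionality of classes turns agreement on the carrier into equality,
  which makes the roles of the two spaces interchangeable.\<close>

lemma pullback_H1_homotopy_inverse:
  assumes \<phi>: "continuous_map X Y \<phi>" and \<psi>: "continuous_map Y X \<psi>"
    and hom: "homotopic_with (\<lambda>_. True) Y Y (\<phi> \<circ> \<psi>) id" and \<xi>: "\<xi> \<in> real_H1 Y"
  shows "pullback_H1 Y X \<psi> (pullback_H1 X Y \<phi> \<xi>) = \<xi>"
proof (rule extensionalityI [of _ "carrier (homology_group 1 Y)"])
  show "pullback_H1 Y X \<psi> (pullback_H1 X Y \<phi> \<xi>) \<in> extensional (carrier (homology_group 1 Y))"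
    by (simp add: pullback_H1_def)
  show "\<xi> \<in> extensional (carrier (homology_group 1 Y))"
    using \<xi> by (simp add: real_H1_def)
  fix c assume c: "c \<in> carrier (homology_group 1 Y)"
  have "hom_induced 1 X {} Y {} \<phi> (hom_induced 1 Y {} X {} \<psi> c) = hom_induced 1 Y {} Y {} (\<phi> \<circ> \<psi>) c"
    by (rule hom_induced_compose' [OF \<psi> _ \<phi>]) auto
  also have "\<dots> = hom_induced 1 Y {} Y {} id c"
    using homology_homotopy_axiom [of "{}" "{}" Y Y "\<phi> \<circ> \<psi>" id 1] hom by simp
  also have "\<dots> = c"
    using c by (rule hom_induced_id)
  finally show "pullback_H1 Y X \<psi> (pullback_H1 X Y \<phi> \<xi>) c = \<xi> c"
    using c hom_induced_carrier [of 1 Y "{}" X "{}" \<psi> c] by (simp add: pullback_H1_def)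
qed

section \<open>Uniform bounds for line integrals\<close>

text \<open>The joined path is chosen before the form, since two forms will be compared along the
  same path.\<close>

lemma pathin_join:
  assumes \<gamma>: "pathin X \<gamma>" and \<delta>: "pathin X \<delta>" and meet: "\<gamma> 1 = \<delta> 0"
  obtains \<eta> where "pathin X \<eta>" "\<eta> 0 = \<gamma> 0" "\<eta> 1 = \<delta> 1"
    "\<And>\<omega>. \<omega> \<in> closed_1forms X \<Longrightarrow>
        line_integral \<omega> \<eta> 0 1 = line_integral \<omega> \<gamma> 0 1 + line_integral \<omega> \<delta> 0 1"
proof -
  define \<eta> where "\<eta> t = (if t \<le> 1/2 then \<gamma> (2 * t) else \<delta> (2 * t - 1))" for t :: real
  have \<gamma>': "continuous_map (top_of_set {0..1/2}) X (\<lambda>t. \<gamma> (2 * t))"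
    by (rule continuous_map_reparametrize [OF \<gamma> [unfolded pathin_def]])
      (auto intro!: continuous_intros)
  have \<delta>': "continuous_map (top_of_set {1/2..1}) X (\<lambda>t. \<delta> (2 * t - 1))"
    by (rule continuous_map_reparametrize [OF \<delta> [unfolded pathin_def]])
      (auto intro!: continuous_intros)
  have \<eta>: "pathin X \<eta>"
    unfolding pathin_def \<eta>_def
  proof (rule continuous_map_cases_le)
    show "continuous_map (subtopology (top_of_set {0..1})
        {t \<in> topspace (top_of_set {0..1}). t \<le> 1/2}) X (\<lambda>t. \<gamma> (2 * t))"
      unfolding subtopology_subtopology
      by (rule continuous_map_from_subtopology_mono [OF \<gamma>']) auto
    show "continuous_map (subtopology (top_of_set {0..1})
        {t \<in> topspace (top_of_set {0..1}). 1/2 \<le> t}) X (\<lambda>t. \<delta> (2 * t - 1))"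
      unfolding subtopology_subtopology
      by (rule continuous_map_from_subtopology_mono [OF \<delta>']) auto
    show "\<gamma> (2 * t) = \<delta> (2 * t - 1)" if "t = 1/2" for t
      unfolding that using meet by simp
  qed (auto intro!: continuous_intros)
  have "line_integral \<omega> \<eta> 0 1 = line_integral \<omega> \<gamma> 0 1 + line_integral \<omega> \<delta> 0 1"
    if \<omega>: "\<omega> \<in> closed_1forms X" for \<omega>
  proof -
    have "line_integral \<omega> (\<lambda>t. \<gamma> (2 * t)) 0 (1/2) = line_integral \<omega> \<eta> 0 (1/2)"
      by (rule line_integral_cong [OF \<omega> \<gamma>']) (auto simp: \<eta>_def)
    moreover have "line_integral \<omega> (\<lambda>t. \<gamma> (2 * t)) 0 (1/2) = line_integral \<omega> \<gamma> 0 1"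
      by (rule line_integral_reparametrize [OF \<omega> \<gamma> [unfolded pathin_def]])
        (auto intro!: continuous_intros)
    moreover have "line_integral \<omega> (\<lambda>t. \<delta> (2 * t - 1)) (1/2) 1 = line_integral \<omega> \<eta> (1/2) 1"
    proof (rule line_integral_cong [OF \<omega> \<delta>'])
      show "\<delta> (2 * s - 1) = \<eta> s" if s: "s \<in> {1/2..1}" for s
      \<comment> \<open>At the midpoint \<eta> is defined by its first branch, so the second one
        agrees there only through \<open>meet\<close>.\<close>
      proof (cases "s = 1/2")
        case True
        show ?thesis unfolding True \<eta>_def using meet by simp
      qed (use s in \<open>simp add: \<eta>_def\<close>)
    qed simp
    moreover have "line_integral \<omega> (\<lambda>t. \<delta> (2 * t - 1)) (1/2) 1 = line_integral \<omega> \<delta> 0 1"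
      by (rule line_integral_reparametrize [OF \<omega> \<delta> [unfolded pathin_def]])
        (auto intro!: continuous_intros)
    moreover have "line_integral \<omega> \<eta> 0 1 = line_integral \<omega> \<eta> 0 (1/2) + line_integral \<omega> \<eta> (1/2) 1"
      by (rule line_integral_additive [OF \<omega> \<eta> [unfolded pathin_def]]) auto
    ultimately show ?thesis by simp
  qed
  moreover have "\<eta> 0 = \<gamma> 0" "\<eta> 1 = \<delta> 1" by (simp_all add: \<eta>_def)
  ultimately show ?thesis using that \<eta> by blast
qed

lemma pathin_reverse:
  assumes \<gamma>: "pathin X \<gamma>"
  shows "pathin X (\<lambda>t. \<gamma> (1 - t))"
    and "\<omega> \<in> closed_1forms X \<Longrightarrow> line_integral \<omega> (\<lambda>t. \<gamma> (1 - t)) 0 1 = - line_integral \<omega> \<gamma> 0 1"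
proof -
  have \<sigma>: "continuous_on {0..1} (\<lambda>t::real. 1 - t)" "(\<lambda>t::real. 1 - t) \<in> {0..1} \<rightarrow> {0..1}"
    by (auto intro!: continuous_intros)
  show "pathin X (\<lambda>t. \<gamma> (1 - t))"
    using continuous_map_reparametrize [OF \<gamma> [unfolded pathin_def] \<sigma>] by (simp add: pathin_def)
  show "line_integral \<omega> (\<lambda>t. \<gamma> (1 - t)) 0 1 = - line_integral \<omega> \<gamma> 0 1" if "\<omega> \<in> closed_1forms X"
    by (rule line_integral_reverse [OF that \<gamma> [unfolded pathin_def] _ _ \<sigma>]) auto
qed

section \<open>Bounds along the tracks of a homotopy\<close>

lemma continuous_map_family_path:
  assumes "continuous_map (prod_topology T K) X (\<lambda>(t, x). H t x)" "x \<in> topspace K"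
  shows "continuous_map T X (\<lambda>t. H t x)"
proof -
  have "continuous_map T (prod_topology T K) (\<lambda>t. (t, x))"
    using assms(2) by (simp add: continuous_map_pairedI)
  from continuous_map_compose [OF this assms(1)] show ?thesis
    by (simp add: o_def)
qed

text \<open>Near \<open>(s, x)\<close> the homotopy stays in a part of one member \<open>U\<close>
  where \<open>f U\<close> is within 1 of its value at \<open>H s x\<close>. The integral is a
  difference of two such values, hence the bound 2.\<close>

lemma line_integral_small_on_box:
  assumes \<omega>: "\<omega> \<in> closed_1forms X"
    and H: "continuous_map (prod_topology (top_of_set {0..1}) K) X (\<lambda>(t, x). H t x)"
    and s: "s \<in> {0..1::real}" and x: "x \<in> topspace K"
  obtains k B where "k > 0" "openin K B" "x \<in> B"
    "\<And>c d y. \<lbrakk>0 \<le> c; c \<le> s; s \<le> d; d \<le> 1; d - c < k; y \<in> B\<rbrakk> \<Longrightarrow>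
        \<bar>line_integral \<omega> (\<lambda>t. H t y) c d\<bar> \<le> 2"
proof -
  obtain \<U> f where A: "(\<U>, f) \<in> form_families X" "(\<U>, f) \<in> \<omega>"
    using closed_1form_representative [OF \<omega>] by metis
  have "(s, x) \<in> topspace (prod_topology (top_of_set {0..1}) K)"
    using s x by simp
  from funcset_mem [OF continuous_map_funspace [OF H] this] have "H s x \<in> topspace X"
    by simp
  moreover have "\<Union>\<U> = topspace X" "\<And>U. U \<in> \<U> \<Longrightarrow> openin X U"
    using A(1) by (simp_all add: form_families_def)
  ultimately obtain U where U: "U \<in> \<U>" "H s x \<in> U" "openin X U"
    by blast
  have fU: "continuous_map (subtopology X U) euclideanreal (f U)"
    using A(1) U(1) by (simp add: form_families_def)
  define V where "V = {y \<in> topspace (subtopology X U). f U y \<in> ball (f U (H s x)) 1}"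
  have "openin (subtopology X U) V"
    unfolding V_def by (rule openin_continuous_map_preimage [OF fU]) simp
  then have "openin X V"
    using U(3) openin_trans_full by blast
  have VU: "V \<subseteq> U" and osc: "\<And>y. y \<in> V \<Longrightarrow> \<bar>f U y - f U (H s x)\<bar> < 1"
    by (auto simp: V_def dist_real_def)
  have "H s x \<in> V"
    using U \<open>H s x \<in> topspace X\<close> by (simp add: V_def)
  define T where "T = {p \<in> topspace (prod_topology (top_of_set {0..1}) K). (\<lambda>(t, x). H t x) p \<in> V}"
  have "openin (prod_topology (top_of_set {0..1}) K) T"
    unfolding T_def by (rule openin_continuous_map_preimage [OF H \<open>openin X V\<close>])
  moreover have "(s, x) \<in> T"
    using s x \<open>H s x \<in> V\<close> by (simp add: T_def)
  ultimately obtain S B where SB: "openin (top_of_set {0..1}) S" "openin K B" "s \<in> S" "x \<in> B" "S \<times> B \<subseteq> T"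
    unfolding openin_prod_topology_alt by meson
  obtain k where k: "k > 0" "\<And>u. u \<in> {0..1} \<Longrightarrow> dist u s < k \<Longrightarrow> u \<in> S"
    using SB(1,3) unfolding openin_euclidean_subtopology_iff by blast
  have "\<bar>line_integral \<omega> (\<lambda>t. H t y) c d\<bar> \<le> 2"
    if *: "0 \<le> c" "c \<le> s" "s \<le> d" "d \<le> 1" "d - c < k" "y \<in> B" for c d y
  proof -
    have inV: "H u y \<in> V" if "u \<in> {c..d}" for u
    proof -
      have "u \<in> S"
        using that * by (intro k(2)) (auto simp: dist_real_def)
      then have "(u, y) \<in> T" using SB(5) \<open>y \<in> B\<close> by blast
      then show ?thesis by (simp add: T_def)
    qed
    have "y \<in> topspace K"
      using openin_subset [OF SB(2)] \<open>y \<in> B\<close> by blast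
    then have path: "continuous_map (top_of_set {c..d}) X (\<lambda>t. H t y)"
      using continuous_map_from_subtopology_mono [OF continuous_map_family_path [OF H]] * by auto
    have "line_integral \<omega> (\<lambda>t. H t y) c d = f U (H d y) - f U (H c y)"
      by (rule line_integral_in_set [OF \<omega> path _ A(2) U(1)]) (use * inV VU in auto)
    moreover have "H c y \<in> V" "H d y \<in> V" using inV * by auto
    ultimately show ?thesis
      using osc [of "H c y"] osc [of "H d y"] by linarith
  qed
  then show ?thesis
    using that k(1) SB(2,4) by blast
qed

text \<open>Bisection in the time variable with \<open>x\<close> fixed: for adjacent time intervals
  the neighbourhoods of \<open>x\<close> are intersected and the bounds added. This is a tube
  argument carried out for integrals.\<close>

lemma line_integral_locally_bounded:
  assumes \<omega>: "\<omega> \<in> closed_1forms X"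
    and H: "continuous_map (prod_topology (top_of_set {0..1::real}) K) X (\<lambda>(t, x). H t x)"
    and x: "x \<in> topspace K"
  shows "\<exists>B C. openin K B \<and> x \<in> B \<and> (\<forall>y\<in>B. \<bar>line_integral \<omega> (\<lambda>t. H t y) 0 1\<bar> \<le> C)"
proof -
  let ?Q = "\<lambda>c d. \<exists>B C. openin K B \<and> x \<in> B \<and> (\<forall>y\<in>B. \<bar>line_integral \<omega> (\<lambda>t. H t y) c d\<bar> \<le> C)"
  have "0 \<le> (0::real) \<and> 1 \<le> (1::real) \<longrightarrow> ?Q 0 1"
  proof (rule Bolzano [where P = "\<lambda>c d. 0 \<le> c \<and> d \<le> 1 \<longrightarrow> ?Q c d"])
    fix c d e :: real
    assume "0 \<le> c \<and> d \<le> 1 \<longrightarrow> ?Q c d" "0 \<le> d \<and> e \<le> 1 \<longrightarrow> ?Q d e" and le: "c \<le> d" "d \<le> e"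
    show "0 \<le> c \<and> e \<le> 1 \<longrightarrow> ?Q c e"
    proof
      assume ce: "0 \<le> c \<and> e \<le> 1"
      then have "?Q c d" "?Q d e"
        using \<open>0 \<le> c \<and> d \<le> 1 \<longrightarrow> ?Q c d\<close> \<open>0 \<le> d \<and> e \<le> 1 \<longrightarrow> ?Q d e\<close> le
        by (meson order.trans)+
      then obtain B C B' C' where B: "openin K B" "x \<in> B"
          "\<And>y. y \<in> B \<Longrightarrow> \<bar>line_integral \<omega> (\<lambda>t. H t y) c d\<bar> \<le> C"
        and B': "openin K B'" "x \<in> B'"
          "\<And>y. y \<in> B' \<Longrightarrow> \<bar>line_integral \<omega> (\<lambda>t. H t y) d e\<bar> \<le> C'"
        by blast
      have "\<bar>line_integral \<omega> (\<lambda>t. H t y) c e\<bar> \<le> C + C'" if y: "y \<in> B \<inter> B'" for y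
      proof -
        have "y \<in> topspace K"
          using openin_subset [OF B(1)] y by blast
        then have "continuous_map (top_of_set {c..e}) X (\<lambda>t. H t y)"
          using continuous_map_from_subtopology_mono [OF continuous_map_family_path [OF H]] ce by auto
        from line_integral_additive [OF \<omega> this le] B(3) [of y] B'(3) [of y] y
        show ?thesis by auto
      qed
      then show "?Q c e"
        using B(1,2) B'(1,2) by (intro exI [of _ "B \<inter> B'"] exI [of _ "C + C'"]) auto
    qed
  next
    fix s :: real assume "0 \<le> s" "s \<le> 1"
    then have "s \<in> {0..1}" by simp
    from line_integral_small_on_box [OF \<omega> H this x] obtain k B where "k > 0" "openin K B" "x \<in> B"
      "\<And>c d y. \<lbrakk>0 \<le> c; c \<le> s; s \<le> d; d \<le> 1; d - c < k; y \<in> B\<rbrakk> \<Longrightarrow>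
          \<bar>line_integral \<omega> (\<lambda>t. H t y) c d\<bar> \<le> 2"
      by blast
    then show "\<exists>k>0. \<forall>c d. c \<le> s \<and> s \<le> d \<and> d - c < k \<longrightarrow> 0 \<le> c \<and> d \<le> 1 \<longrightarrow> ?Q c d"
      by (intro exI [of _ k]) blast
  qed simp
  then show ?thesis by simp
qed

lemma line_integral_bounded_on_compact:
  assumes \<omega>: "\<omega> \<in> closed_1forms X" and K: "compact_space K"
    and H: "continuous_map (prod_topology (top_of_set {0..1::real}) K) X (\<lambda>(t, x). H t x)"
  obtains C where "\<And>x. x \<in> topspace K \<Longrightarrow> \<bar>line_integral \<omega> (\<lambda>t. H t x) 0 1\<bar> \<le> C"
proof -
  obtain B C where BC: "\<And>x. x \<in> topspace K \<Longrightarrow> openin K (B x)" "\<And>x. x \<in> topspace K \<Longrightarrow> x \<in> B x"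
    "\<And>x y. \<lbrakk>x \<in> topspace K; y \<in> B x\<rbrakk> \<Longrightarrow> \<bar>line_integral \<omega> (\<lambda>t. H t y) 0 1\<bar> \<le> C x"
    using line_integral_locally_bounded [OF \<omega> H] by metis
  have "\<exists>\<F>. finite \<F> \<and> \<F> \<subseteq> B ` topspace K \<and> topspace K \<subseteq> \<Union>\<F>"
  proof -
    have "\<forall>U\<in>B ` topspace K. openin K U" "topspace K \<subseteq> \<Union>(B ` topspace K)"
      using BC(1,2) by blast+
    then show ?thesis
      using K unfolding compact_space_alt by simp
  qed
  then obtain F where F: "finite F" "F \<subseteq> topspace K" "topspace K \<subseteq> (\<Union>x\<in>F. B x)"
    by (metis finite_subset_image)
  \<comment> \<open>The sum serves as a common upper bound and makes sense also for empty
    \<open>F\<close>.\<close>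
  have "\<bar>line_integral \<omega> (\<lambda>t. H t y) 0 1\<bar> \<le> (\<Sum>x\<in>F. \<bar>C x\<bar>)" if y: "y \<in> topspace K" for y
  proof -
    obtain x where x: "x \<in> F" "y \<in> B x" using F(3) y by blast
    then have "\<bar>line_integral \<omega> (\<lambda>t. H t y) 0 1\<bar> \<le> \<bar>C x\<bar>"
      using BC(3) [of x y] F(2) by auto
    also have "\<dots> \<le> (\<Sum>x\<in>F. \<bar>C x\<bar>)"
      using member_le_sum [of x F "\<lambda>x. \<bar>C x\<bar>"] x F(1) by simp
    finally show ?thesis .
  qed
  then show ?thesis using that by blast
qed

section \<open>Finite CW-complexes\<close>

text \<open>The disc consists of functions on all natural numbers that vanish from \<open>n\<close>
  on, so Tychonoff's theorem applies: it is a closed subset of an infinite product of intervals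
  \<open>{-1..1}\<close>.\<close>

lemma compact_space_cw_disc: "compact_space (cw_disc n)"
proof -
  let ?P = "powertop_real (UNIV :: nat set)"
  define S where "S = {x::nat \<Rightarrow> real. (\<forall>i\<ge>n. x i = 0) \<and> (\<Sum>i<n. x i ^ 2) \<le> 1}"
  have eq: "cw_disc n = subtopology ?P S"
    by (simp add: cw_disc_def Euclidean_space_def subtopology_subtopology S_def Collect_conj_eq)
  have proj: "continuous_map ?P euclideanreal (\<lambda>x. x i)" for i
    by (rule continuous_map_product_projection [where X = "\<lambda>_. euclideanreal"]) simp
  have "closedin ?P {x \<in> topspace ?P. (\<Sum>i<n. x i ^ 2) \<in> {..1}}"
    by (rule closedin_continuous_map_preimage [where Y = euclideanreal])
      (auto intro!: continuous_map_sum continuous_map_real_pow proj)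
  moreover have "closedin ?P {x \<in> topspace ?P. x i \<in> {0}}" for i
    by (rule closedin_continuous_map_preimage [OF proj]) simp
  then have "closedin ?P ((\<Inter>i\<in>{n..}. {x \<in> topspace ?P. x i \<in> {0}}))"
    by (intro closedin_Inter) auto
  ultimately have "closedin ?P ((\<Inter>i\<in>{n..}. {x \<in> topspace ?P. x i \<in> {0}}) \<inter>
       {x \<in> topspace ?P. (\<Sum>i<n. x i ^ 2) \<in> {..1}})"
    by (intro closedin_Int)
  also have "\<dots> = S"
    by (auto simp: S_def)
  finally have "closedin ?P S" .
  moreover have "compactin ?P (PiE UNIV (\<lambda>_. {-1..1}))"
    by (simp add: compactin_PiE)
  moreover have "S \<subseteq> PiE UNIV (\<lambda>_. {-1..1})"
  proof
    fix x assume x: "x \<in> S"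
    have "x i \<in> {-1..1}" for i
    proof (cases "i < n")
      case True
      have "x i ^ 2 \<le> (\<Sum>i<n. x i ^ 2)"
        using member_le_sum [of i "{..<n}" "\<lambda>i. x i ^ 2"] True by simp
      then have "x i ^ 2 \<le> 1" using x by (simp add: S_def)
      then show ?thesis by (simp add: abs_square_le_1 abs_le_iff)
    qed (use x in \<open>simp add: S_def\<close>)
    then show "x \<in> PiE UNIV (\<lambda>_. {-1..1})" by (auto simp: PiE_UNIV_domain)
  qed
  ultimately have "compactin ?P S"
    by (meson closed_compactin)
  then show ?thesis
    unfolding eq by (simp add: compact_space_subtopology)
qed

text \<open>The disc is star-shaped about its centre. This contraction is the source of the radial
  paths in the cells.\<close>

lemma continuous_map_cw_disc_scale:
  "continuous_map (prod_topology (top_of_set {0..1::real}) (cw_disc n)) (cw_disc n) (\<lambda>(t, p) i. t * p i)"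
proof -
  let ?T = "prod_topology (top_of_set {0..1::real}) (cw_disc n)"
  have "continuous_map (cw_disc n) euclideanreal (\<lambda>x. x i)" for i
    unfolding cw_disc_def Euclidean_space_def subtopology_subtopology
    by (rule continuous_map_from_subtopology
          [OF continuous_map_product_projection [where X = "\<lambda>_. euclideanreal"]]) simp
  then have "continuous_map ?T euclideanreal (\<lambda>z. snd z i)" for i
    using continuous_map_compose [OF continuous_map_snd, of "cw_disc n" euclideanreal "\<lambda>x. x i"]
    by (simp add: o_def)
  moreover have "continuous_map ?T euclideanreal fst"
    by (rule continuous_map_into_fulltopology [OF continuous_map_fst])
  ultimately have "continuous_map ?T (powertop_real UNIV) (\<lambda>z i. fst z * snd z i)"
    by (simp add: continuous_map_componentwise_UNIV continuous_map_real_mult)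
  moreover have "(\<Sum>i<n. (t * p i)\<^sup>2) \<le> 1" if "t \<in> {0..1}" "(\<Sum>i<n. (p i)\<^sup>2) \<le> 1" for t :: real and p
  proof -
    have "(\<Sum>i<n. (t * p i)\<^sup>2) \<le> (\<Sum>i<n. (p i)\<^sup>2)"
    proof (rule sum_mono)
      fix i
      have "t\<^sup>2 \<le> 1" using that(1) by (simp add: power_le_one)
      then show "(t * p i)\<^sup>2 \<le> (p i)\<^sup>2"
        using mult_right_mono [of "t\<^sup>2" 1 "(p i)\<^sup>2"] by (simp add: power_mult_distrib)
    qed
    with that(2) show ?thesis by linarith
  qed
  ultimately show ?thesis
    unfolding case_prod_unfold
    by (auto simp: cw_disc_def Euclidean_space_def continuous_map_in_subtopology)
qed

lemma finite_CW_complex_cover: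
  assumes "finite_CW_complex X"
  obtains m :: nat and d \<Phi> where "\<And>i. i < m \<Longrightarrow> continuous_map (cw_disc (d i)) X (\<Phi> i)"
    "topspace X = (\<Union>i<m. \<Phi> i ` topspace (cw_disc (d i)))"
proof -
  obtain m d \<Phi> where *: "finite_CW_structure X m d \<Phi>"
    using assms by (auto simp: finite_CW_complex_def)
  then have c: "continuous_map (cw_disc (d i)) X (\<Phi> i)" if "i < m" for i
    using that by (simp add: finite_CW_structure_def)
  have "topspace X = (\<Union>i<m. \<Phi> i ` disc_interior (d i))"
    using * by (simp add: finite_CW_structure_def)
  then have "topspace X \<subseteq> (\<Union>i<m. \<Phi> i ` topspace (cw_disc (d i)))"
    by (auto simp: disc_interior_def)
  moreover have "(\<Union>i<m. \<Phi> i ` topspace (cw_disc (d i))) \<subseteq> topspace X"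
    using continuous_map_image_subset_topspace [OF c] by blast
  ultimately show ?thesis using that c by blast
qed

lemma finite_CW_complex_imp_compact_space:
  assumes "finite_CW_complex X"
  shows "compact_space X"
proof -
  obtain m :: nat and d \<Phi> where *: "\<And>i. i < m \<Longrightarrow> continuous_map (cw_disc (d i)) X (\<Phi> i)"
    "topspace X = (\<Union>i<m. \<Phi> i ` topspace (cw_disc (d i)))"
    using finite_CW_complex_cover [OF assms] by blast
  have "compactin X (\<Phi> i ` topspace (cw_disc (d i)))" if "i < m" for i
    using image_compactin [OF _ *(1) [OF that]] compact_space_cw_disc by (simp add: compact_space_def)
  then have "compactin X (\<Union>i<m. \<Phi> i ` topspace (cw_disc (d i)))"
    by (intro compactin_Union) auto
  then show ?thesis
    unfolding *(2) [symmetric] by (simp add: compact_space_def)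
qed

text \<open>The path to \<open>x\<close> is the image of a radius, and \<open>Z\<close> consists of
  the images of the centres. The assignment of paths to points may be discontinuous; the bound is
  nevertheless uniform, because on each compact disc all radii together form one homotopy.\<close>

lemma finite_CW_complex_radial_paths:
  assumes "finite_CW_complex X"
  obtains Z \<sigma> where "finite Z"
    "\<And>x. x \<in> topspace X \<Longrightarrow> pathin X (\<sigma> x) \<and> \<sigma> x 0 \<in> Z \<and> \<sigma> x 1 = x"
    "\<And>\<omega>. \<omega> \<in> closed_1forms X \<Longrightarrow> \<exists>C. \<forall>x\<in>topspace X. \<bar>line_integral \<omega> (\<sigma> x) 0 1\<bar> \<le> C"
proof -
  obtain m :: nat and d \<Phi> where \<Phi>: "\<And>i. i < m \<Longrightarrow> continuous_map (cw_disc (d i)) X (\<Phi> i)"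
    and top: "topspace X = (\<Union>i<m. \<Phi> i ` topspace (cw_disc (d i)))"
    using finite_CW_complex_cover [OF assms] by blast
  \<comment> \<open>Images of closed discs overlap, so a cell and a preimage are chosen arbitrarily
    for each point.\<close>
  have "\<forall>x\<in>topspace X. \<exists>i p. i < m \<and> p \<in> topspace (cw_disc (d i)) \<and> x = \<Phi> i p"
    unfolding top by blast
  then obtain c p where cp: "\<And>x. x \<in> topspace X \<Longrightarrow> c x < m"
    "\<And>x. x \<in> topspace X \<Longrightarrow> p x \<in> topspace (cw_disc (d (c x)))"
    "\<And>x. x \<in> topspace X \<Longrightarrow> x = \<Phi> (c x) (p x)"
    by metis
  define H where "H i t q = \<Phi> i (\<lambda>k. t * q k)" for i :: nat and t :: real and q :: "nat \<Rightarrow> real"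
  have H: "continuous_map (prod_topology (top_of_set {0..1}) (cw_disc (d i))) X (\<lambda>(t, q). H i t q)"
    if "i < m" for i
    using continuous_map_compose [OF continuous_map_cw_disc_scale \<Phi> [OF that]]
    by (simp add: H_def o_def case_prod_unfold)
  define \<sigma> where "\<sigma> x = (\<lambda>t. H (c x) t (p x))" for x
  show ?thesis
  proof
    show "finite ((\<lambda>i. \<Phi> i (\<lambda>_. 0)) ` {..<m})" by simp
    show "pathin X (\<sigma> x) \<and> \<sigma> x 0 \<in> (\<lambda>i. \<Phi> i (\<lambda>_. 0)) ` {..<m} \<and> \<sigma> x 1 = x" if x: "x \<in> topspace X" for x
    proof (intro conjI)
      show "pathin X (\<sigma> x)"
        unfolding pathin_def \<sigma>_def by (rule continuous_map_family_path [OF H]) (use cp x in auto)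
      show "\<sigma> x 0 \<in> (\<lambda>i. \<Phi> i (\<lambda>_. 0)) ` {..<m}"
        using cp(1) [OF x] by (simp add: \<sigma>_def H_def)
      show "\<sigma> x 1 = x"
        using cp(3) [OF x] by (simp add: \<sigma>_def H_def)
    qed
    fix \<omega> assume \<omega>: "\<omega> \<in> closed_1forms X"
    have "\<forall>i. \<exists>C. i < m \<longrightarrow> (\<forall>q\<in>topspace (cw_disc (d i)). \<bar>line_integral \<omega> (\<lambda>t. H i t q) 0 1\<bar> \<le> C)"
      using line_integral_bounded_on_compact [OF \<omega> compact_space_cw_disc H] by metis
    then obtain C where C: "\<And>i q. \<lbrakk>i < m; q \<in> topspace (cw_disc (d i))\<rbrakk> \<Longrightarrow>
        \<bar>line_integral \<omega> (\<lambda>t. H i t q) 0 1\<bar> \<le> C i"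
      by metis
    have "\<bar>line_integral \<omega> (\<sigma> x) 0 1\<bar> \<le> (\<Sum>i<m. \<bar>C i\<bar>)" if x: "x \<in> topspace X" for x
    proof -
      have "\<bar>line_integral \<omega> (\<sigma> x) 0 1\<bar> \<le> \<bar>C (c x)\<bar>"
        unfolding \<sigma>_def using C [OF cp(1,2) [OF x]] by linarith
      also have "\<dots> \<le> (\<Sum>i<m. \<bar>C i\<bar>)"
        using member_le_sum [of "c x" "{..<m}" "\<lambda>i. \<bar>C i\<bar>"] cp(1) [OF x] by simp
      finally show ?thesis .
    qed
    then show "\<exists>C. \<forall>x\<in>topspace X. \<bar>line_integral \<omega> (\<sigma> x) 0 1\<bar> \<le> C" by blast
  qed
qed

text \<open>Equal periods make the difference \<open>D\<close> of the two integrals vanish on loops,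
  so \<open>D\<close> depends only on endpoints. Radial paths at both ends move the endpoints into
  the finite set \<open>Z\<close>, where only finitely many values occur.\<close>

lemma line_integral_diff_bounded:
  assumes X: "finite_CW_complex X" and "represents X \<omega> \<xi>" "represents X \<omega>' \<xi>"
  obtains C where "\<And>a b \<gamma>. \<lbrakk>a \<le> b; continuous_map (top_of_set {a..b}) X \<gamma>\<rbrakk> \<Longrightarrow>
      \<bar>line_integral \<omega> \<gamma> a b - line_integral \<omega>' \<gamma> a b\<bar> \<le> C"
proof -
  have \<omega>: "\<omega> \<in> closed_1forms X" "\<omega>' \<in> closed_1forms X"
    using assms by (simp_all add: represents_def)
  define D where "D \<gamma> = line_integral \<omega> \<gamma> 0 1 - line_integral \<omega>' \<gamma> 0 1" for \<gamma>
  have loop: "D \<gamma> = 0" if "pathin X \<gamma>" "\<gamma> 0 = \<gamma> 1" for \<gamma>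
  proof -
    have "\<xi> (loop_class X \<gamma>) = line_integral \<omega> \<gamma> 0 1" "\<xi> (loop_class X \<gamma>) = line_integral \<omega>' \<gamma> 0 1"
      using assms(2,3) that by (simp_all add: represents_def)
    then show ?thesis by (simp add: D_def)
  qed
  have join: "\<exists>\<eta>. pathin X \<eta> \<and> \<eta> 0 = \<gamma> 0 \<and> \<eta> 1 = \<delta> 1 \<and> D \<eta> = D \<gamma> + D \<delta>"
    if path: "pathin X \<gamma>" "pathin X \<delta>" "\<gamma> 1 = \<delta> 0" for \<gamma> \<delta>
  proof -
    from pathin_join [OF path] obtain \<eta> where \<eta>: "pathin X \<eta>" "\<eta> 0 = \<gamma> 0" "\<eta> 1 = \<delta> 1"
      "\<And>\<omega>. \<omega> \<in> closed_1forms X \<Longrightarrow>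
          line_integral \<omega> \<eta> 0 1 = line_integral \<omega> \<gamma> 0 1 + line_integral \<omega> \<delta> 0 1"
      by blast
    then have "D \<eta> = D \<gamma> + D \<delta>"
      using \<omega> by (simp add: D_def)
    with \<eta>(1-3) show ?thesis by blast
  qed
  have rev: "pathin X (\<lambda>t. \<gamma> (1 - t))" "D (\<lambda>t. \<gamma> (1 - t)) = - D \<gamma>" if "pathin X \<gamma>" for \<gamma>
    using pathin_reverse [OF that] \<omega> by (simp_all add: D_def)
  have ends: "D \<gamma> = D \<delta>"
    if path: "pathin X \<gamma>" "pathin X \<delta>" and end0: "\<gamma> 0 = \<delta> 0" and end1: "\<gamma> 1 = \<delta> 1" for \<gamma> \<delta>
  proof -
    from join [OF path(1) rev(1) [OF path(2)]] end1
    obtain \<eta> where \<eta>: "pathin X \<eta>" "\<eta> 0 = \<gamma> 0" "\<eta> 1 = \<delta> 0" "D \<eta> = D \<gamma> - D \<delta>"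
      using rev(2) [OF path(2)] by auto
    with loop [of \<eta>] end0 show ?thesis by simp
  qed
  obtain Z \<sigma> where Z: "finite Z"
    and \<sigma>: "\<And>x. x \<in> topspace X \<Longrightarrow> pathin X (\<sigma> x) \<and> \<sigma> x 0 \<in> Z \<and> \<sigma> x 1 = x"
    and bound: "\<And>\<omega>. \<omega> \<in> closed_1forms X \<Longrightarrow> \<exists>C. \<forall>x\<in>topspace X. \<bar>line_integral \<omega> (\<sigma> x) 0 1\<bar> \<le> C"
    using finite_CW_complex_radial_paths [OF X] by metis
  obtain C C' where C: "\<And>x. x \<in> topspace X \<Longrightarrow> \<bar>line_integral \<omega> (\<sigma> x) 0 1\<bar> \<le> C"
    "\<And>x. x \<in> topspace X \<Longrightarrow> \<bar>line_integral \<omega>' (\<sigma> x) 0 1\<bar> \<le> C'"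
    using bound [OF \<omega>(1)] bound [OF \<omega>(2)] by blast
  have D\<sigma>: "\<bar>D (\<sigma> x)\<bar> \<le> C + C'" if "x \<in> topspace X" for x
    using C(1) [OF that] C(2) [OF that] by (simp add: D_def)
  \<comment> \<open>Pairs of points in different path components satisfy this vacuously; for the
    others \<open>D\<close> takes a single value.\<close>
  have "\<exists>B. \<forall>\<tau>. pathin X \<tau> \<and> \<tau> 0 = z \<and> \<tau> 1 = w \<longrightarrow> \<bar>D \<tau>\<bar> \<le> B" for z w
  proof (cases "\<exists>\<tau>. pathin X \<tau> \<and> \<tau> 0 = z \<and> \<tau> 1 = w")
    case True
    then obtain \<tau> where "pathin X \<tau>" "\<tau> 0 = z" "\<tau> 1 = w" by blast
    then have "D \<tau>' = D \<tau>" if "pathin X \<tau>' \<and> \<tau>' 0 = z \<and> \<tau>' 1 = w" for \<tau>'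
      using ends [of \<tau>' \<tau>] that by simp
    then show ?thesis by (intro exI [of _ "\<bar>D \<tau>\<bar>"]) simp
  qed blast
  then obtain B where B: "\<And>z w \<tau>. \<lbrakk>pathin X \<tau>; \<tau> 0 = z; \<tau> 1 = w\<rbrakk> \<Longrightarrow> \<bar>D \<tau>\<bar> \<le> B z w"
    by metis
  define M where "M = (\<Sum>(z, w)\<in>Z \<times> Z. \<bar>B z w\<bar>)"
  \<comment> \<open>\<open>M\<close> bounds \<open>D\<close> between centres, and each of the two
    radial paths costs at most \<open>C + C'\<close>, one summand for each form.\<close>
  have unit: "\<bar>D \<gamma>\<bar> \<le> M + 2 * (C + C')" if \<gamma>: "pathin X \<gamma>" for \<gamma>
  proof -
    have x: "\<gamma> 0 \<in> topspace X" and y: "\<gamma> 1 \<in> topspace X"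
      using \<gamma> by (auto simp: pathin_def dest!: continuous_map_image_subset_topspace)
    from join [of "\<sigma> (\<gamma> 0)" \<gamma>] \<sigma> [OF x] \<gamma> obtain \<eta> where
      \<eta>: "pathin X \<eta>" "\<eta> 0 = \<sigma> (\<gamma> 0) 0" "\<eta> 1 = \<gamma> 1" "D \<eta> = D (\<sigma> (\<gamma> 0)) + D \<gamma>"
      by auto
    have \<sigma>y: "pathin X (\<sigma> (\<gamma> 1))" "\<sigma> (\<gamma> 1) 1 = \<gamma> 1"
      using \<sigma> [OF y] by auto
    from join [OF \<eta>(1) rev(1) [OF \<sigma>y(1)]] \<eta>(3) \<sigma>y(2) obtain \<zeta> where
      \<zeta>: "pathin X \<zeta>" "\<zeta> 0 = \<eta> 0" "\<zeta> 1 = \<sigma> (\<gamma> 1) 0" "D \<zeta> = D \<eta> - D (\<sigma> (\<gamma> 1))"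
      using rev(2) [OF \<sigma>y(1)] by auto
    have mem: "(\<sigma> (\<gamma> 0) 0, \<sigma> (\<gamma> 1) 0) \<in> Z \<times> Z"
      using \<sigma> [OF x] \<sigma> [OF y] by simp
    have "\<bar>D \<zeta>\<bar> \<le> \<bar>B (\<sigma> (\<gamma> 0) 0) (\<sigma> (\<gamma> 1) 0)\<bar>"
      using B [OF \<zeta>(1-3)] \<eta>(2) by simp
    also have "\<dots> \<le> M"
      unfolding M_def using member_le_sum [OF mem, of "\<lambda>(z, w). \<bar>B z w\<bar>"] Z by auto
    finally have "\<bar>D \<zeta>\<bar> \<le> M" .
    \<comment> \<open>Pure arithmetic, to be read with \<open>r\<close>, \<open>e\<close>,
      \<open>z\<close> as the values of \<open>D\<close> on \<gamma>, \<eta>, \<zeta> and with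
      \<open>p\<close>, \<open>q\<close> as those on the two radial paths.\<close>
    moreover have "\<bar>r\<bar> \<le> M + 2 * c" if "\<bar>z\<bar> \<le> M" "e = p + r" "z = e - q" "\<bar>p\<bar> \<le> c" "\<bar>q\<bar> \<le> c"
        for r z e p q c :: real
      using that by linarith
    ultimately show ?thesis
      using \<eta>(4) \<zeta>(4) D\<sigma> [OF x] D\<sigma> [OF y] by blast
  qed
  have "\<bar>line_integral \<omega> \<gamma> a b - line_integral \<omega>' \<gamma> a b\<bar> \<le> M + 2 * (C + C')"
    if "a \<le> b" and \<gamma>: "continuous_map (top_of_set {a..b}) X \<gamma>" for a b \<gamma>
  proof -
    have \<rho>: "continuous_on {0..1} (\<lambda>t. a + t * (b - a))"
      by (intro continuous_intros)
    have \<rho>': "(\<lambda>t. a + t * (b - a)) \<in> {0..1} \<rightarrow> {a..b}"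
    proof
      fix t :: real assume "t \<in> {0..1}"
      then show "a + t * (b - a) \<in> {a..b}"
        using \<open>a \<le> b\<close> mult_left_le_one_le [of "b - a" t] by simp
    qed
    have "pathin X (\<lambda>t. \<gamma> (a + t * (b - a)))"
      unfolding pathin_def by (rule continuous_map_reparametrize [OF \<gamma> \<rho> \<rho>'])
    from unit [OF this] show ?thesis
      using line_integral_reparametrize [OF \<omega>(1) \<gamma> \<open>a \<le> b\<close> _ \<rho> \<rho>']
        line_integral_reparametrize [OF \<omega>(2) \<gamma> \<open>a \<le> b\<close> _ \<rho> \<rho>'] by (simp add: D_def)
  qed
  then show ?thesis using that by blast
qed

section \<open>Transfer of covers\<close>

text \<open>On the preimage the inclusion is homotopic to \<open>\<psi> \<circ> \<phi>\<close>,
  which factors through the inclusion of \<open>S\<close> and therefore contracts to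
  \<open>\<psi> a\<close>.\<close>

lemma null_homotopic_inclusion_preimage:
  assumes \<phi>: "continuous_map X Y \<phi>" and \<psi>: "continuous_map Y X \<psi>"
    and hom: "homotopic_with (\<lambda>_. True) X X (\<psi> \<circ> \<phi>) id"
    and null: "null_homotopic_inclusion Y S"
  shows "null_homotopic_inclusion X {x \<in> topspace X. \<phi> x \<in> S}"
proof -
  let ?R = "{x \<in> topspace X. \<phi> x \<in> S}"
  obtain a where a: "a \<in> topspace Y" "homotopic_with (\<lambda>_. True) (subtopology Y S) Y id (\<lambda>_. a)"
    using null by (auto simp: null_homotopic_inclusion_def)
  have \<phi>R: "continuous_map (subtopology X ?R) (subtopology Y S) \<phi>"
    by (rule continuous_map_into_subtopology [OF continuous_map_from_subtopology [OF \<phi>]]) auto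
  have "homotopic_with (\<lambda>_. True) (subtopology X ?R) Y (id \<circ> \<phi>) ((\<lambda>_. a) \<circ> \<phi>)"
    by (rule homotopic_with_compose_continuous_map_right [OF a(2) \<phi>R]) simp
  then have "homotopic_with (\<lambda>_. True) (subtopology X ?R) X (\<psi> \<circ> (id \<circ> \<phi>)) (\<psi> \<circ> ((\<lambda>_. a) \<circ> \<phi>))"
    by (rule homotopic_with_compose_continuous_map_left [OF _ \<psi>]) simp
  then have "homotopic_with (\<lambda>_. True) (subtopology X ?R) X (\<psi> \<circ> \<phi>) (\<lambda>_. \<psi> a)"
    by (simp add: o_def)
  with homotopic_with_symD [OF homotopic_from_subtopology [OF hom]]
  have "homotopic_with (\<lambda>_. True) (subtopology X ?R) X id (\<lambda>_. \<psi> a)"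
    by (rule homotopic_with_trans)
  moreover have "\<psi> a \<in> topspace X"
    using continuous_map_image_subset_topspace [OF \<psi>] a(1) by blast
  ultimately show ?thesis
    by (auto simp: null_homotopic_inclusion_def)
qed

text \<open>The expression \<open>t - max (-1) (min 1 t)\<close> collapses \<open>{-1..1}\<close> to
  0 and shifts both rays by one unit towards 0, so one continuous formula starts the flow in both
  time directions. Through the absolute value both directions begin with the same homotopy
  \<open>k\<close>. The pieces fit at time 1 in absolute value because \<open>k 1\<close> is
  \<open>\<psi> \<circ> \<phi>\<close> on \<open>X\<close> and \<open>h 0\<close> is the
  inclusion.\<close>

lemma continuous_map_homotopy_then_flow:
  fixes h :: "real \<Rightarrow> 'b \<Rightarrow> 'b"
  assumes \<phi>: "continuous_map X Y \<phi>" and \<psi>: "continuous_map Y X \<psi>"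
    and k: "continuous_map (prod_topology (top_of_set {0..1::real}) X) X (\<lambda>(t, x). k t x)"
    and k1: "\<And>x. x \<in> topspace X \<Longrightarrow> k 1 x = \<psi> (\<phi> x)"
    and h: "continuous_map (prod_topology euclideanreal (subtopology Y F)) Y (\<lambda>(t, y). h t y)"
    and h0: "\<And>y. y \<in> F \<Longrightarrow> h 0 y = y"
  defines "R \<equiv> {x \<in> topspace X. \<phi> x \<in> F}"
  shows "continuous_map (prod_topology euclideanreal (subtopology X R)) X
     (\<lambda>(t, x). if \<bar>t\<bar> \<le> 1 then k \<bar>t\<bar> x else \<psi> (h (t - max (-1) (min 1 t)) (\<phi> x)))"
proof -
  let ?T = "prod_topology euclideanreal (subtopology X R)"
  have topT: "topspace ?T = UNIV \<times> R"
    by (auto simp: R_def)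
  have cfst: "continuous_map ?T euclideanreal fst"
    by (rule continuous_map_fst)
  have csnd: "continuous_map ?T X snd"
    by (rule continuous_map_into_fulltopology [OF continuous_map_snd])
  have abs: "continuous_map ?T euclideanreal (\<lambda>p. \<bar>fst p\<bar>)"
    by (rule continuous_map_real_abs [OF cfst])
  have "continuous_map ?T X (\<lambda>p. if \<bar>fst p\<bar> \<le> 1 then k \<bar>fst p\<bar> (snd p)
        else \<psi> (h (fst p - max (-1) (min 1 (fst p))) (\<phi> (snd p))))"
  proof (rule continuous_map_cases_le [OF abs])
    show "continuous_map ?T euclideanreal (\<lambda>_. 1)" by simp
    let ?S = "subtopology ?T {p \<in> topspace ?T. \<bar>fst p\<bar> \<le> 1}"
    have "continuous_map ?S (prod_topology (top_of_set {0..1}) X) (\<lambda>p. (\<bar>fst p\<bar>, snd p))"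
      by (intro continuous_map_pairedI continuous_map_into_subtopology
          continuous_map_from_subtopology abs csnd) auto
    from continuous_map_compose [OF this k]
    show "continuous_map ?S X (\<lambda>p. k \<bar>fst p\<bar> (snd p))"
      by (simp add: o_def)
    have \<phi>R: "continuous_map (subtopology X R) (subtopology Y F) \<phi>"
      by (rule continuous_map_into_subtopology [OF continuous_map_from_subtopology [OF \<phi>]])
        (auto simp: R_def)
    have "continuous_map euclideanreal euclideanreal (\<lambda>t. t - max (-1) (min 1 t))"
      by (auto intro!: continuous_intros)
    from continuous_map_compose [OF cfst this]
    have "continuous_map ?T euclideanreal (\<lambda>p. fst p - max (-1) (min 1 (fst p)))"
      by (simp add: o_def)
    moreover from continuous_map_compose [OF continuous_map_snd \<phi>R]
    have "continuous_map ?T (subtopology Y F) (\<lambda>p. \<phi> (snd p))"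
      by (simp add: o_def)
    ultimately have "continuous_map ?T (prod_topology euclideanreal (subtopology Y F))
        (\<lambda>p. (fst p - max (-1) (min 1 (fst p)), \<phi> (snd p)))"
      by (rule continuous_map_pairedI)
    from continuous_map_compose [OF continuous_map_compose [OF this h] \<psi>]
    have "continuous_map ?T X (\<lambda>p. \<psi> (h (fst p - max (-1) (min 1 (fst p))) (\<phi> (snd p))))"
      by (simp add: o_def)
    then show "continuous_map (subtopology ?T {p \<in> topspace ?T. 1 \<le> \<bar>fst p\<bar>}) X
        (\<lambda>p. \<psi> (h (fst p - max (-1) (min 1 (fst p))) (\<phi> (snd p))))"
      by (rule continuous_map_from_subtopology)
  next
    fix p assume p: "p \<in> topspace ?T" "\<bar>fst p\<bar> = 1"
    then have "fst p - max (-1) (min 1 (fst p)) = 0"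
      by (auto simp: abs_if split: if_splits)
    moreover have "snd p \<in> topspace X" "\<phi> (snd p) \<in> F"
      using p(1) unfolding topT by (auto simp: R_def)
    ultimately show "k \<bar>fst p\<bar> (snd p) = \<psi> (h (fst p - max (-1) (min 1 (fst p))) (\<phi> (snd p)))"
      using k1 h0 p(2) by simp
  qed
  then show ?thesis by (simp add: case_prod_unfold)
qed

lemma line_integral_homotopy_then_path:
  assumes \<omega>: "\<omega> \<in> closed_1forms X" and "1 \<le> T"
    and \<delta>: "continuous_map (top_of_set {0..T}) X \<delta>"
    and k: "continuous_map (top_of_set {0..1}) X \<kappa>" "\<And>s. s \<in> {0..1} \<Longrightarrow> \<delta> s = \<kappa> s"
    and \<eta>: "continuous_map (top_of_set {0..T - 1}) X \<eta>" "\<And>s. s \<in> {1..T} \<Longrightarrow> \<delta> s = \<eta> (s - 1)"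
  shows "line_integral \<omega> \<delta> 0 T = line_integral \<omega> \<kappa> 0 1 + line_integral \<omega> \<eta> 0 (T - 1)"
proof -
  have "line_integral \<omega> \<delta> 0 T = line_integral \<omega> \<delta> 0 1 + line_integral \<omega> \<delta> 1 T"
    by (rule line_integral_additive [OF \<omega> \<delta>]) (use \<open>1 \<le> T\<close> in auto)
  moreover have "line_integral \<omega> \<kappa> 0 1 = line_integral \<omega> \<delta> 0 1"
    by (rule line_integral_cong [OF \<omega> k(1)]) (use k(2) in auto)
  moreover have \<sigma>: "continuous_on {1..T} (\<lambda>t. t - 1)" "(\<lambda>t. t - 1) \<in> {1..T} \<rightarrow> {0..T - 1}"
    by (auto intro!: continuous_intros)
  have "line_integral \<omega> (\<lambda>t. \<eta> (t - 1)) 1 T = line_integral \<omega> \<delta> 1 T"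
    by (rule line_integral_cong [OF \<omega> continuous_map_reparametrize [OF \<eta>(1) \<sigma>]])
      (use \<open>1 \<le> T\<close> \<eta>(2) in auto)
  moreover have "line_integral \<omega> (\<lambda>t. \<eta> (t - 1)) 1 T = line_integral \<omega> \<eta> 0 (T - 1)"
    by (rule line_integral_reparametrize [OF \<omega> \<eta>(1) _ _ \<sigma>]) (use \<open>1 \<le> T\<close> in auto)
  ultimately show ?thesis by simp
qed

text \<open>Two errors arise, both independent of the point and of the time: compactness of
  \<open>X\<close> bounds the integral of the initial homotopy, and the cells of \<open>Y\<close>
  bound the difference between the given form on \<open>Y\<close> and the pullback of \<omega> in
  the same class.\<close>

lemma movable_preimage:
  assumes X: "compact_space X" and Y: "finite_CW_complex Y"
    and \<phi>: "continuous_map X Y \<phi>" and \<psi>: "continuous_map Y X \<psi>"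
    and hom: "homotopic_with (\<lambda>_. True) X X (\<psi> \<circ> \<phi>) id"
    and \<omega>: "represents X \<omega> \<xi>" and \<omega>': "represents Y \<omega>' (pullback_H1 Y X \<psi> \<xi>)"
    and F: "F \<subseteq> topspace Y" "movable Y \<omega>' F"
  shows "movable X \<omega> {x \<in> topspace X. \<phi> x \<in> F}"
proof -
  define R where "R = {x \<in> topspace X. \<phi> x \<in> F}"
  have \<omega>c: "\<omega> \<in> closed_1forms X"
    using \<omega> by (simp add: represents_def)
  have "pullback_H1 Y X \<psi> \<xi> \<in> real_H1 Y"
    using \<omega>' by (simp add: represents_def)
  from represents_pullback [OF \<psi> \<omega> this] obtain \<omega>'' where
    \<omega>'': "represents Y \<omega>'' (pullback_H1 Y X \<psi> \<xi>)"
    and pull: "\<And>\<gamma> a b. \<lbrakk>a \<le> b; continuous_map (top_of_set {a..b}) Y \<gamma>\<rbrakk> \<Longrightarrow>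
        line_integral \<omega>'' \<gamma> a b = line_integral \<omega> (\<lambda>t. \<psi> (\<gamma> t)) a b"
    by metis
  obtain C where C: "\<And>a b \<gamma>. \<lbrakk>a \<le> b; continuous_map (top_of_set {a..b}) Y \<gamma>\<rbrakk> \<Longrightarrow>
      \<bar>line_integral \<omega>'' \<gamma> a b - line_integral \<omega>' \<gamma> a b\<bar> \<le> C"
    using line_integral_diff_bounded [OF Y \<omega>'' \<omega>'] by metis
  obtain K where K: "continuous_map (prod_topology (top_of_set {0..1::real}) X) X K"
    "\<And>x. K (0, x) = x" "\<And>x. K (1, x) = \<psi> (\<phi> x)"
    using homotopic_with_symD [OF hom] by (auto simp: homotopic_with_def)
  define k where "k t x = K (t, x)" for t x
  have k: "continuous_map (prod_topology (top_of_set {0..1::real}) X) X (\<lambda>(t, x). k t x)"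
    and k01: "\<And>x. k 0 x = x" "\<And>x. k 1 x = \<psi> (\<phi> x)"
    using K by (simp_all add: k_def)
  obtain C' where C': "\<And>x. x \<in> topspace X \<Longrightarrow> \<bar>line_integral \<omega> (\<lambda>t. k t x) 0 1\<bar> \<le> C'"
    using line_integral_bounded_on_compact [OF \<omega>c X k] by blast
  obtain h where h: "continuous_map (prod_topology euclideanreal (subtopology Y F)) Y (\<lambda>(t, y). h t y)"
    and h0: "\<And>y. y \<in> F \<Longrightarrow> h 0 y = y"
    and flow: "\<And>n::int. n > 0 \<Longrightarrow> \<exists>N::real. N > 0 \<and>
        (\<forall>y\<in>F. (\<forall>t. t > N \<longrightarrow> line_integral \<omega>' (\<lambda>\<tau>. h \<tau> y) 0 t > of_int n) \<and>
               (\<forall>t. t < - N \<longrightarrow> line_integral \<omega>' (\<lambda>\<tau>. h (- \<tau>) y) 0 (- t) < - of_int n))"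
    using F(2) unfolding movable_def by blast
  define h' where "h' t x = (if \<bar>t\<bar> \<le> 1 then k \<bar>t\<bar> x else \<psi> (h (t - max (-1) (min 1 t)) (\<phi> x)))" for t x
  have h': "continuous_map (prod_topology euclideanreal (subtopology X R)) X (\<lambda>(t, x). h' t x)"
    unfolding h'_def R_def by (rule continuous_map_homotopy_then_flow [OF \<phi> \<psi> k k01(2) h h0])
  \<comment> \<open>The sign \<open>e\<close> treats positive and negative times together. The
    integral on \<open>Y\<close> stops at \<open>T - 1\<close> because the initial homotopy uses up
    one unit of time.\<close>
  have compare: "\<bar>line_integral \<omega> (\<lambda>\<tau>. h' (e * \<tau>) x) 0 T
      - line_integral \<omega>' (\<lambda>\<tau>. h (e * \<tau>) (\<phi> x)) 0 (T - 1)\<bar> \<le> C + C'"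
    if e: "e = 1 \<or> e = -1" and T: "1 \<le> T" and x: "x \<in> R" for e T x
  proof -
    have xX: "x \<in> topspace X" and xF: "\<phi> x \<in> F" using x by (auto simp: R_def)
    have lin: "continuous_map (top_of_set S) euclideanreal (\<lambda>\<tau>. e * \<tau>)" for S
      by (auto intro!: continuous_intros)
    have "continuous_map euclideanreal X (\<lambda>t. h' t x)"
      by (rule continuous_map_family_path [OF h']) (use xX x in auto)
    from continuous_map_compose [OF lin this]
    have \<delta>: "continuous_map (top_of_set {0..T}) X (\<lambda>\<tau>. h' (e * \<tau>) x)"
      by (simp add: o_def)
    have "continuous_map euclideanreal Y (\<lambda>t. h t (\<phi> x))"
      by (rule continuous_map_family_path [OF h]) (use xF F in auto)
    from continuous_map_compose [OF lin this]
    have hpath: "continuous_map (top_of_set {0..T - 1}) Y (\<lambda>\<tau>. h (e * \<tau>) (\<phi> x))"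
      by (simp add: o_def)
    from continuous_map_compose [OF this \<psi>]
    have \<eta>: "continuous_map (top_of_set {0..T - 1}) X (\<lambda>\<tau>. \<psi> (h (e * \<tau>) (\<phi> x)))"
      by (simp add: o_def)
    have "h' (e * s) x = \<psi> (h (e * (s - 1)) (\<phi> x))" if "s \<in> {1..T}" for s
    proof (cases "s = 1")
      case True
      then show ?thesis using e k01 h0 xF by (auto simp: h'_def)
    next
      case False
      then have "s > 1" using that by simp
      then have "\<not> \<bar>e * s\<bar> \<le> 1" "e * s - max (-1) (min 1 (e * s)) = e * (s - 1)"
        using e by (auto simp: algebra_simps)
      then show ?thesis by (simp add: h'_def)
    qed
    moreover have "h' (e * s) x = k s x" if "s \<in> {0..1}" for s
      using that e by (auto simp: h'_def)
    ultimately have "line_integral \<omega> (\<lambda>\<tau>. h' (e * \<tau>) x) 0 T = line_integral \<omega> (\<lambda>\<tau>. k \<tau> x) 0 1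
        + line_integral \<omega> (\<lambda>\<tau>. \<psi> (h (e * \<tau>) (\<phi> x))) 0 (T - 1)"
      by (intro line_integral_homotopy_then_path [OF \<omega>c T \<delta> continuous_map_family_path [OF k xX] _ \<eta>])
    moreover have "line_integral \<omega> (\<lambda>\<tau>. \<psi> (h (e * \<tau>) (\<phi> x))) 0 (T - 1) =
        line_integral \<omega>'' (\<lambda>\<tau>. h (e * \<tau>) (\<phi> x)) 0 (T - 1)"
      using pull [OF _ hpath] T by simp
    moreover have "\<bar>line_integral \<omega>'' (\<lambda>\<tau>. h (e * \<tau>) (\<phi> x)) 0 (T - 1) -
        line_integral \<omega>' (\<lambda>\<tau>. h (e * \<tau>) (\<phi> x)) 0 (T - 1)\<bar> \<le> C"
      using C [OF _ hpath] T by simp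
    ultimately show ?thesis
      using C' [OF xX] by linarith
  qed
  have "\<exists>N::real. N > 0 \<and> (\<forall>x\<in>R.
      (\<forall>t. t > N \<longrightarrow> line_integral \<omega> (\<lambda>\<tau>. h' \<tau> x) 0 t > of_int n) \<and>
      (\<forall>t. t < - N \<longrightarrow> line_integral \<omega> (\<lambda>\<tau>. h' (- \<tau>) x) 0 (- t) < - of_int n))"
    if n: "n > 0" for n :: int
  proof -
    \<comment> \<open>The flow on \<open>Y\<close> has to exceed \<open>n\<close> by the total
      error. The absolute value keeps the integer positive whatever the sign of
      \<open>C + C'\<close>.\<close>
    define m where "m = n + \<bar>\<lceil>C + C'\<rceil>\<bar>"
    have "C + C' \<le> of_int \<bar>\<lceil>C + C'\<rceil>\<bar>"
      by (rule order.trans [OF le_of_int_ceiling]) simp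
    then have m: "m > 0" "of_int n + (C + C') \<le> of_int m"
      using n by (simp_all add: m_def)
    obtain N where N: "N > 0"
      and pos: "\<And>y t. \<lbrakk>y \<in> F; t > N\<rbrakk> \<Longrightarrow> line_integral \<omega>' (\<lambda>\<tau>. h \<tau> y) 0 t > of_int m"
      and neg: "\<And>y t. \<lbrakk>y \<in> F; t < - N\<rbrakk> \<Longrightarrow>
          line_integral \<omega>' (\<lambda>\<tau>. h (- \<tau>) y) 0 (- t) < - of_int m"
      using flow [OF m(1)] by blast
    have "line_integral \<omega> (\<lambda>\<tau>. h' \<tau> x) 0 t > of_int n" if "x \<in> R" "t > N + 1" for x t
      using compare [of 1 t x] pos [of "\<phi> x" "t - 1"] that N m(2) by (simp add: R_def)
    moreover have "line_integral \<omega> (\<lambda>\<tau>. h' (- \<tau>) x) 0 (- t) < - of_int n"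
      if "x \<in> R" "t < - (N + 1)" for x t
      using compare [of "-1" "-t" x] neg [of "\<phi> x" "t + 1"] that N m(2) by (simp add: R_def)
    ultimately show ?thesis
      \<comment> \<open>The extra 1 is the duration of the initial homotopy.\<close>
      using N by (intro exI [of _ "N + 1"]) auto
  qed
  moreover have "\<forall>x\<in>R. h' 0 x = x"
    using k01 by (simp add: h'_def)
  ultimately have "movable X \<omega> R"
    unfolding movable_def using h' by blast
  then show ?thesis
    by (simp add: R_def)
qed

text \<open>Both forms are arbitrary representatives, which is what the choice inside
  \<open>Cat\<close> requires. For identity maps this contains the independence of
  \<open>Cat_cover\<close> from the representing form.\<close>

lemma Cat_cover_transfer:
  assumes X: "compact_space X" and Y: "finite_CW_complex Y"
    and \<phi>: "continuous_map X Y \<phi>" and \<psi>: "continuous_map Y X \<psi>"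
    and hom: "homotopic_with (\<lambda>_. True) X X (\<psi> \<circ> \<phi>) id"
    and \<omega>: "represents X \<omega> \<xi>" and \<omega>': "represents Y \<omega>' (pullback_H1 Y X \<psi> \<xi>)"
    and cover: "Cat_cover Y \<omega>' k"
  shows "Cat_cover X \<omega> k"
proof -
  define pre where "pre S = {x \<in> topspace X. \<phi> x \<in> S}" for S
  obtain F G where FG: "openin Y F \<and> (\<forall>j\<in>{1..k}. openin Y (G j)) \<and>
        topspace Y = F \<union> (\<Union>j\<in>{1..k}. G j) \<and>
        (\<forall>j\<in>{1..k}. null_homotopic_inclusion Y (G j)) \<and> movable Y \<omega>' F"
    using cover unfolding Cat_cover_def by (elim exE)
  then have F: "openin Y F" "movable Y \<omega>' F"
    and G: "\<And>j. j \<in> {1..k} \<Longrightarrow> openin Y (G j)" "\<And>j. j \<in> {1..k} \<Longrightarrow> null_homotopic_inclusion Y (G j)"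
    and top: "topspace Y = F \<union> (\<Union>j\<in>{1..k}. G j)"
    by simp_all
  have op: "openin X (pre S)" if "openin Y S" for S
    unfolding pre_def by (rule openin_continuous_map_preimage [OF \<phi> that])
  have "topspace X = pre F \<union> (\<Union>j\<in>{1..k}. pre (G j))"
  proof
    show "topspace X \<subseteq> pre F \<union> (\<Union>j\<in>{1..k}. pre (G j))"
    proof
      fix x assume x: "x \<in> topspace X"
      with continuous_map_image_subset_topspace [OF \<phi>] have "\<phi> x \<in> F \<union> (\<Union>j\<in>{1..k}. G j)"
        unfolding top by blast
      with x show "x \<in> pre F \<union> (\<Union>j\<in>{1..k}. pre (G j))"
        by (auto simp: pre_def)
    qed
  qed (auto simp: pre_def)
  moreover have "movable X \<omega> (pre F)"
    unfolding pre_def using movable_preimage [OF X Y \<phi> \<psi> hom \<omega> \<omega>' openin_subset [OF F(1)] F(2)] .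
  moreover have "null_homotopic_inclusion X (pre (G j))" if "j \<in> {1..k}" for j
    unfolding pre_def by (rule null_homotopic_inclusion_preimage [OF \<phi> \<psi> hom G(2) [OF that]])
  ultimately show ?thesis
    unfolding Cat_cover_def using op F(1) G(1)
    by (intro exI [of _ "pre F"] exI [of _ "\<lambda>j. pre (G j)"]) auto
qed

theorem lemma4p1:
  fixes X\<^sub>1 :: "'a topology" and X\<^sub>2 :: "'b topology" and \<phi> :: "'a \<Rightarrow> 'b"
    and \<xi>\<^sub>1 :: "'a chain set \<Rightarrow> real" and \<xi>\<^sub>2 :: "'b chain set \<Rightarrow> real"
  assumes "finite_CW_complex X\<^sub>1" and "finite_CW_complex X\<^sub>2"
    and "homotopy_equivalence_map X\<^sub>1 X\<^sub>2 \<phi>"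
    and "\<xi>\<^sub>1 \<in> real_H1 X\<^sub>1" and "\<xi>\<^sub>2 \<in> real_H1 X\<^sub>2"
    and "\<xi>\<^sub>1 = pullback_H1 X\<^sub>1 X\<^sub>2 \<phi> \<xi>\<^sub>2"
  shows "Cat X\<^sub>1 \<xi>\<^sub>1 = Cat X\<^sub>2 \<xi>\<^sub>2"
proof -
  obtain \<psi> where \<phi>: "continuous_map X\<^sub>1 X\<^sub>2 \<phi>" and \<psi>: "continuous_map X\<^sub>2 X\<^sub>1 \<psi>"
    and hom1: "homotopic_with (\<lambda>_. True) X\<^sub>1 X\<^sub>1 (\<psi> \<circ> \<phi>) id"
    and hom2: "homotopic_with (\<lambda>_. True) X\<^sub>2 X\<^sub>2 (\<phi> \<circ> \<psi>) id"
    using assms(3) unfolding homotopy_equivalence_map_def by blast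
  \<comment> \<open>The hypothesis on the classes becomes symmetric, so each transfer below can also
    be run with the spaces exchanged.\<close>
  have \<xi>\<^sub>2: "\<xi>\<^sub>2 = pullback_H1 X\<^sub>2 X\<^sub>1 \<psi> \<xi>\<^sub>1"
    using pullback_H1_homotopy_inverse [OF \<phi> \<psi> hom2 assms(5)] assms(6) by simp
  have ex2: "\<exists>\<omega>. represents X\<^sub>2 \<omega> \<xi>\<^sub>2" if "represents X\<^sub>1 \<omega> \<xi>\<^sub>1" for \<omega>
    by (rule represents_pullback [OF \<psi> that]) (use assms(5) \<xi>\<^sub>2 in auto)
  have ex1: "\<exists>\<omega>. represents X\<^sub>1 \<omega> \<xi>\<^sub>1" if "represents X\<^sub>2 \<omega> \<xi>\<^sub>2" for \<omega>
    by (rule represents_pullback [OF \<phi> that]) (use assms(4,6) in auto)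
  \<comment> \<open>Stated for every pair of representatives, so that it applies to the two
    unrelated chosen forms. Equality as predicates of \<open>k\<close> gives equal least
    elements.\<close>
  have cover: "Cat_cover X\<^sub>1 \<omega>\<^sub>1 = Cat_cover X\<^sub>2 \<omega>\<^sub>2"
    if \<omega>\<^sub>1: "represents X\<^sub>1 \<omega>\<^sub>1 \<xi>\<^sub>1" and \<omega>\<^sub>2: "represents X\<^sub>2 \<omega>\<^sub>2 \<xi>\<^sub>2" for \<omega>\<^sub>1 \<omega>\<^sub>2
  proof (intro ext iffI)
    fix k
    have p1: "represents X\<^sub>1 \<omega>\<^sub>1 (pullback_H1 X\<^sub>1 X\<^sub>2 \<phi> \<xi>\<^sub>2)"
      using \<omega>\<^sub>1 assms(6) by simp
    have p2: "represents X\<^sub>2 \<omega>\<^sub>2 (pullback_H1 X\<^sub>2 X\<^sub>1 \<psi> \<xi>\<^sub>1)"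
      using \<omega>\<^sub>2 \<xi>\<^sub>2 by simp
    show "Cat_cover X\<^sub>1 \<omega>\<^sub>1 k" if "Cat_cover X\<^sub>2 \<omega>\<^sub>2 k"
      using Cat_cover_transfer [OF finite_CW_complex_imp_compact_space [OF assms(1)] assms(2)
          \<phi> \<psi> hom1 \<omega>\<^sub>1 p2 that] .
    show "Cat_cover X\<^sub>2 \<omega>\<^sub>2 k" if "Cat_cover X\<^sub>1 \<omega>\<^sub>1 k"
      using Cat_cover_transfer [OF finite_CW_complex_imp_compact_space [OF assms(2)] assms(1)
          \<psi> \<phi> hom2 \<omega>\<^sub>2 p1 that] .
  qed
  show ?thesis
  proof (cases "\<exists>\<omega>. represents X\<^sub>1 \<omega> \<xi>\<^sub>1")
    case True
    then have True': "\<exists>\<omega>. represents X\<^sub>2 \<omega> \<xi>\<^sub>2"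
      using ex2 by (elim exE)
    have "Cat_cover X\<^sub>1 (SOME \<omega>. represents X\<^sub>1 \<omega> \<xi>\<^sub>1) = Cat_cover X\<^sub>2 (SOME \<omega>. represents X\<^sub>2 \<omega> \<xi>\<^sub>2)"
      by (rule cover [OF someI_ex [OF True] someI_ex [OF True']])
    then show ?thesis
      unfolding Cat_def if_P [OF True] if_P [OF True'] by simp
  next
    case False
    then have False': "\<not> (\<exists>\<omega>. represents X\<^sub>2 \<omega> \<xi>\<^sub>2)"
      \<comment> \<open>Representability passes between the spaces in both directions, so here both
        numbers are the default value 0.\<close>
      using ex1 by blast
    show ?thesis
      unfolding Cat_def if_not_P [OF False] if_not_P [OF False'] ..
  qed
qed

end
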